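(* For $g\geq 1$, $\mathrm{Sp}(2g,\mathbb{Z}_2)$ is the smallest non-cyclic quotient of $\mathrm{Sp}(2g,\mathbb{Z})$. For $g\geq 3$, $\mathrm{Sp}(2g,\mathbb{Z}_2)$ is the smallest non-trivial quotient of $\mathrm{Sp}(2g,\mathbb{Z})$.
   Context: $\mathbb{Z}_2=\mathbb{Z}/2\mathbb{Z}$. "The smallest non-cyclic (resp. non-trivial) quotient is $Q$" means that $Q$ is a non-cyclic (resp. non-trivial) quotient and every non-cyclic (resp. non-trivial) quotient either has order larger than $|Q|$ or is isomorphic to $Q$. The trivial group counts as cyclic. *)

theory Defs
  imports
    "HOL-Algebra.Elementary_Groups"
    "HOL-Library.Equipollence"
    "HOL-Library.Z2"
    "Jordan_Normal_Form.Determinant"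
begin

text \<open>The standard symplectic form, with respect to a basis
  \<open>a\<^sub>1, \<dots>, a\<^sub>g, b\<^sub>1, \<dots>, b\<^sub>g\<close>.\<close>

definition symplectic_form :: "nat \<Rightarrow> 'a :: comm_ring_1 mat" where
  "symplectic_form g =
     four_block_mat (0\<^sub>m g g) (1\<^sub>m g) (- 1\<^sub>m g) (0\<^sub>m g g)"

text \<open>\<open>Sp TYPE('a) g\<close> is Sp(2g, R), where the ring of coefficients R is the type \<open>'a\<close>.\<close>

definition Sp :: "'a :: comm_ring_1 itself \<Rightarrow> nat \<Rightarrow> 'a mat monoid" where
  "Sp ty g = \<lparr>carrier = {A \<in> carrier_mat (2 * g) (2 * g).
                        transpose_mat A * symplectic_form g * A = symplectic_form g},
           monoid.mult = (*), one = 1\<^sub>m (2 * g)\<rparr>"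

text \<open>\<open>Q\<close> is the smallest among the quotients of \<open>G\<close> with the (isomorphism-invariant)
  property \<open>P\<close>. Orders are compared by \<open>\<prec>\<close> (strictly smaller cardinality) because
  \<open>order\<close> is 0 on infinite groups.\<close>

definition smallest_quotient ::
  "('a set monoid \<Rightarrow> bool) \<Rightarrow> 'a monoid \<Rightarrow> 'b monoid \<Rightarrow> bool" where
  "smallest_quotient P G Q \<longleftrightarrow>
     (\<exists>N. N \<lhd> G \<and> P (G Mod N) \<and> G Mod N \<cong> Q) \<and>
     (\<forall>N. N \<lhd> G \<and> P (G Mod N) \<longrightarrow>
        carrier Q \<prec> carrier (G Mod N) \<or> G Mod N \<cong> Q)"

definition smallest_noncyclic_quotient :: "'a monoid \<Rightarrow> 'b monoid \<Rightarrow> bool" where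
  "smallest_noncyclic_quotient = smallest_quotient (\<lambda>H. \<not> cyclic_group H)"

definition smallest_nontrivial_quotient :: "'a monoid \<Rightarrow> 'b monoid \<Rightarrow> bool" where
  "smallest_nontrivial_quotient = smallest_quotient (\<lambda>H. \<not> trivial_group H)"

lemma symplectic_form_carrier [simp]: "symplectic_form g \<in> carrier_mat (2 * g) (2 * g)"
  unfolding symplectic_form_def mult_2 by (rule four_block_carrier_mat) auto

lemma symplectic_form_square:
  "symplectic_form g * symplectic_form g = - (1\<^sub>m (2 * g) :: 'a :: comm_ring_1 mat)"
proof -
  have "symplectic_form g * symplectic_form g =
    four_block_mat (- 1\<^sub>m g) (0\<^sub>m g g) (0\<^sub>m g g) (- 1\<^sub>m g :: 'a mat)"
    unfolding symplectic_form_def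
    by (subst mult_four_block_mat[of _ g g _ g _ g _ _ g _ g]) auto
  also have "\<dots> = - 1\<^sub>m (2 * g)"
    by (rule eq_matI) auto
  finally show ?thesis .
qed

lemma mat_right_inverse_of_left_inverse:
  fixes A B :: "'a :: comm_ring_1 mat"
  assumes A: "A \<in> carrier_mat n n" and B: "B \<in> carrier_mat n n" and BA: "B * A = 1\<^sub>m n"
  shows "A * B = 1\<^sub>m n"
proof -
  define C where "C = det B \<cdot>\<^sub>m adj_mat A"
  have adj: "adj_mat A \<in> carrier_mat n n" "A * adj_mat A = det A \<cdot>\<^sub>m 1\<^sub>m n"
    using adj_mat[OF A] by auto
  have C: "C \<in> carrier_mat n n"
    using adj by (simp add: C_def)
  have "det B * det A = 1"
    using det_mult[OF B A] BA by simp
  then have AC: "A * C = 1\<^sub>m n"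
    using mult_smult_distrib[OF A adj(1)] adj(2)
    by (auto simp: C_def mult.assoc[symmetric] intro!: eq_matI)
  have "B = B * (A * C)"
    using AC B by simp
  also have "\<dots> = C"
    using assoc_mult_mat[OF B A C] BA C by simp
  finally show ?thesis
    using AC by simp
qed

lemma group_Sp: "group (Sp TYPE('a :: comm_ring_1) g)"
proof -
  define n where "n = 2 * g"
  define J :: "'a mat" where "J = symplectic_form g"
  have J: "J \<in> carrier_mat n n"
    by (simp add: J_def n_def)
  have JJ: "J * J = - 1\<^sub>m n"
    by (simp add: J_def n_def symplectic_form_square)
  have carr: "carrier (Sp TYPE('a) g) = {A \<in> carrier_mat n n. transpose_mat A * J * A = J}"
    and mul: "\<And>A B. A \<otimes>\<^bsub>Sp TYPE('a) g\<^esub> B = A * (B :: 'a mat)"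
    and one: "\<one>\<^bsub>Sp TYPE('a) g\<^esub> = (1\<^sub>m n :: 'a mat)"
    by (simp_all add: Sp_def J_def n_def)
  have conj: "transpose_mat (A * B) * J * (A * B)
      = transpose_mat B * (transpose_mat A * J * A) * B"
    if A: "A \<in> carrier_mat n n" and B: "B \<in> carrier_mat n n" for A B
  proof -
    have At: "transpose_mat A \<in> carrier_mat n n" and Bt: "transpose_mat B \<in> carrier_mat n n"
      using A B by auto
    show ?thesis
      using A B At Bt J by (simp add: transpose_mult[OF A B] assoc_mult_mat[of _ n n _ n _ n])
  qed
  show ?thesis
  proof (rule groupI)
    fix A :: "'a mat"
    assume "A \<in> carrier (Sp TYPE('a) g)"
    then have A: "A \<in> carrier_mat n n" and AJA: "transpose_mat A * J * A = J"
      by (auto simp: carr)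
    have At: "transpose_mat A \<in> carrier_mat n n"
      using A by simp
    define B where "B = - (J * (transpose_mat A * J))"
    have AtJ: "transpose_mat A * J \<in> carrier_mat n n" and JAJ: "J * (transpose_mat A * J) \<in> carrier_mat n n"
      using At J by auto
    then have B: "B \<in> carrier_mat n n"
      by (simp add: B_def)
    have "B * A = - (J * (transpose_mat A * J) * A)"
      unfolding B_def by (rule uminus_mult_left_mat) (use JAJ A in auto)
    also have "J * (transpose_mat A * J) * A = J * J"
      by (simp add: assoc_mult_mat[OF J AtJ A] AJA)
    finally have BA: "B * A = 1\<^sub>m n"
      by (simp add: JJ)
    have AB: "A * B = 1\<^sub>m n"
      by (rule mat_right_inverse_of_left_inverse[OF A B BA])
    have "transpose_mat B * J * B = J"
      using conj[OF A B] AJA AB J by simp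
    then show "\<exists>y\<in>carrier (Sp TYPE('a) g). y \<otimes>\<^bsub>Sp TYPE('a) g\<^esub> A = \<one>\<^bsub>Sp TYPE('a) g\<^esub>"
      using B BA by (auto simp: carr mul one)
  qed (use J in \<open>auto simp: carr mul one conj assoc_mult_mat[of _ n n _ n _ n]\<close>)
qed

end

theory Submission
  imports Defs
begin

text \<open>
  Let \<open>h\<close> be a homomorphism from Sp(2g, Z) onto a non-cyclic group, and write \<open>T\<^sub>v\<close> for the
  transvection along \<open>v\<close>. If \<open>h T\<^sub>v = h T\<^sub>w\<close> and some \<open>z\<close> satisfies \<open>\<omega>(z, v) = 0\<close> and
  \<open>\<omega>(z, w) = \<plusminus>1\<close>, then \<open>h T\<^sub>z\<close> commutes with \<open>h T\<^sub>w\<close>, so by the braid relation they are equal,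
  and then all generating transvections have the same image, contradicting non-cyclicity.
  Consequently \<open>h T\<^sub>v\<close> determines \<open>v\<close> among the vectors with entries in {0, 1}. Following the
  images of a symplectic basis one vector after the other gives a set of representatives of
  Sp(2g, Z/2) in Sp(2g, Z) on which \<open>h\<close> is injective.

  If the image of \<open>h\<close> is not larger than Sp(2g, Z/2), these representatives map onto it, and
  \<open>h T\<^sub>v\<close> depends on \<open>v\<close> modulo 2 only; this is checked for the generating transvections
  applied to 0-1 vectors. Hence the kernel of \<open>h\<close> is contained in the level 2 congruence
  subgroup, and the two coincide by counting. For \<open>g \<ge> 3\<close> the lantern relation shows that
  abelian quotients are trivial.
\<close>

section \<open>The symplectic form and transvections\<close>

text \<open>The bilinear form with Gram matrix \<open>symplectic_form g\<close>, summed over the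
  hyperbolic pairs \<open>ea g i\<close>, \<open>eb g i\<close>; \<open>symp_eq_scalar_prod\<close>
  gives the connection.\<close>

definition symp :: "nat \<Rightarrow> 'a :: comm_ring_1 vec \<Rightarrow> 'a vec \<Rightarrow> 'a" where
  "symp g v w = (\<Sum>i<g. v $ i * w $ (g + i) - v $ (g + i) * w $ i)"

text \<open>The factor depending on \<open>j\<close> lists the coordinates of the functional
  \<open>symp g u\<close>, so this is the matrix of the map sending \<open>w\<close> to
  \<open>w\<close> plus \<open>symp g u w\<close> times \<open>u\<close>.\<close>

definition transvection :: "nat \<Rightarrow> 'a :: comm_ring_1 vec \<Rightarrow> 'a mat" where
  "transvection g u = mat (2 * g) (2 * g)
     (\<lambda>(i, j). (if i = j then 1 else 0) + u $ i * (if j < g then - u $ (g + j) else u $ (j - g)))"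

abbreviation vecs :: "nat \<Rightarrow> 'a :: comm_ring_1 vec set" where
  "vecs g \<equiv> carrier_vec (2 * g)"

abbreviation ea :: "nat \<Rightarrow> nat \<Rightarrow> 'a :: comm_ring_1 vec" where
  "ea g i \<equiv> unit_vec (2 * g) i"

abbreviation eb :: "nat \<Rightarrow> nat \<Rightarrow> 'a :: comm_ring_1 vec" where
  "eb g i \<equiv> unit_vec (2 * g) (g + i)"

lemma sum_lessThan_double:
  fixes f :: "nat \<Rightarrow> 'a :: comm_monoid_add"
  shows "(\<Sum>i\<in>{0..<2 * g}. f i) = (\<Sum>i<g. f i + f (g + i))"
proof -
  have "(\<Sum>i\<in>{0..<2 * g}. f i) = (\<Sum>i\<in>{0..<g}. f i) + (\<Sum>i\<in>{g..<2 * g}. f i)"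
    by (rule sum.atLeastLessThan_concat[symmetric]) auto
  also have "(\<Sum>i\<in>{g..<2 * g}. f i) = (\<Sum>i\<in>{0..<g}. f (g + i))"
    using sum.shift_bounds_nat_ivl[of f 0 g g] by (simp add: mult_2 add.commute)
  finally show ?thesis by (simp add: sum.distrib lessThan_atLeast0)
qed

lemma vec_eq_halvesI:
  assumes "v \<in> vecs g" "w \<in> vecs g"
    and "\<And>i. i < g \<Longrightarrow> v $ i = w $ i" "\<And>i. i < g \<Longrightarrow> v $ (g + i) = w $ (g + i)"
  shows "v = w"
proof (rule eq_vecI)
  fix i assume "i < dim_vec w"
  then show "v $ i = w $ i"
    using assms(2) assms(3)[of i] assms(4)[of "i - g"] by (cases "i < g") auto
qed (use assms in auto)

lemma symp_add_left:
  "u \<in> vecs g \<Longrightarrow> v \<in> vecs g \<Longrightarrow> symp g (u + v) w = symp g u w + symp g v w"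
  by (simp add: symp_def algebra_simps sum.distrib sum_subtractf)

lemma symp_add_right:
  "v \<in> vecs g \<Longrightarrow> w \<in> vecs g \<Longrightarrow> symp g u (v + w) = symp g u v + symp g u w"
  by (simp add: symp_def algebra_simps sum.distrib sum_subtractf)

lemma symp_diff_left:
  "u \<in> vecs g \<Longrightarrow> v \<in> vecs g \<Longrightarrow> symp g (u - v) w = symp g u w - symp g v w"
  by (simp add: symp_def algebra_simps sum.distrib sum_subtractf)

lemma symp_diff_right:
  "v \<in> vecs g \<Longrightarrow> w \<in> vecs g \<Longrightarrow> symp g u (v - w) = symp g u v - symp g u w"
  by (simp add: symp_def algebra_simps sum.distrib sum_subtractf)

lemma symp_smult_left: "u \<in> vecs g \<Longrightarrow> symp g (c \<cdot>\<^sub>v u) w = c * symp g u w"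
  by (simp add: symp_def algebra_simps sum_distrib_left)

lemma symp_smult_right: "w \<in> vecs g \<Longrightarrow> symp g u (c \<cdot>\<^sub>v w) = c * symp g u w"
  by (simp add: symp_def algebra_simps sum_distrib_left)

lemma symp_self [simp]: "symp g u u = 0"
  by (simp add: symp_def mult.commute)

lemma symp_swap: "symp g v u = - symp g u v"
  by (simp add: symp_def sum_negf[symmetric] mult.commute)

lemma symp_ea_left [simp]: "i < g \<Longrightarrow> symp g (ea g i) w = w $ (g + i)"
proof -
  assume i: "i < g"
  have "symp g (ea g i) w = (\<Sum>j<g. if j = i then w $ (g + j) else 0)"
    unfolding symp_def using i by (intro sum.cong) auto
  then show ?thesis using i by simp
qed

lemma symp_eb_left [simp]: "i < g \<Longrightarrow> symp g (eb g i) w = - w $ i"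
proof -
  assume i: "i < g"
  have "symp g (eb g i) w = (\<Sum>j<g. if j = i then - w $ j else 0)"
    unfolding symp_def using i by (intro sum.cong) auto
  then show ?thesis using i by simp
qed

lemma symp_ea_right [simp]: "i < g \<Longrightarrow> symp g w (ea g i) = - w $ (g + i)"
  by (subst symp_swap) simp

lemma symp_eb_right [simp]: "i < g \<Longrightarrow> symp g w (eb g i) = w $ i"
  by (subst symp_swap) simp

lemma transvection_carrier [simp]: "transvection g u \<in> carrier_mat (2 * g) (2 * g)"
  by (simp add: transvection_def)

lemma transvection_mult_vec:
  assumes "u \<in> vecs g" "w \<in> vecs g"
  shows "transvection g u *\<^sub>v w = w + symp g u w \<cdot>\<^sub>v u"
proof (rule eq_vecI)
  fix i assume "i < dim_vec (w + symp g u w \<cdot>\<^sub>v u)"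
  then have i: "i < 2 * g" using assms by simp
  have "(transvection g u *\<^sub>v w) $ i = (\<Sum>j\<in>{0..<2 * g}. transvection g u $$ (i, j) * w $ j)"
    using i assms by (simp add: transvection_def scalar_prod_def)
  also have "\<dots> = (\<Sum>j\<in>{0..<2 * g}. (if j = i then w $ j else 0)) +
     (\<Sum>j\<in>{0..<2 * g}. u $ i * ((if j < g then - u $ (g + j) else u $ (j - g)) * w $ j))"
    unfolding sum.distrib[symmetric] using i
    by (intro sum.cong) (auto simp: transvection_def algebra_simps)
  also have "(\<Sum>j\<in>{0..<2 * g}. (if j = i then w $ j else 0)) = w $ i"
    using i by simp
  also have "(\<Sum>j\<in>{0..<2 * g}. u $ i * ((if j < g then - u $ (g + j) else u $ (j - g)) * w $ j))
     = u $ i * symp g u w"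
    unfolding sum_distrib_left[symmetric] sum_lessThan_double symp_def
    by (intro arg_cong2[of _ _ _ _ "(*)"] sum.cong) (auto simp: algebra_simps)
  finally show "(transvection g u *\<^sub>v w) $ i = (w + symp g u w \<cdot>\<^sub>v u) $ i"
    using i assms by (simp add: mult.commute)
qed (use assms in \<open>auto simp: transvection_def\<close>)

section \<open>The symplectic group as the isometry group of the form\<close>

lemma mat_eq_vecI:
  fixes A B :: "'a :: comm_ring_1 mat"
  assumes "A \<in> carrier_mat n m" "B \<in> carrier_mat n m"
    and eq: "\<And>j. j < m \<Longrightarrow> A *\<^sub>v unit_vec m j = B *\<^sub>v unit_vec m j"
  shows "A = B"
proof (rule eq_matI)
  fix i j assume "i < dim_row B" "j < dim_col B"
  then have ij: "i < n" "j < m" using assms by auto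
  show "A $$ (i, j) = B $$ (i, j)"
    using arg_cong[OF eq[OF ij(2)], of "\<lambda>v. v $ i"] ij assms(1,2) by simp
qed (use assms in auto)

lemma symplectic_form_dim [simp]:
  "dim_row (symplectic_form g) = 2 * g" "dim_col (symplectic_form g) = 2 * g"
  using symplectic_form_carrier by blast+

lemma symplectic_form_mult_vec:
  fixes w :: "'a :: comm_ring_1 vec"
  assumes "w \<in> vecs g" "i < g"
  shows "(symplectic_form g *\<^sub>v w) $ i = w $ (g + i)"
    and "(symplectic_form g *\<^sub>v w) $ (g + i) = - w $ i"
proof -
  let ?J = "symplectic_form g :: 'a mat"
  have *: "(?J *\<^sub>v w) $ k = (\<Sum>j\<in>{0..<2 * g}. ?J $$ (k, j) * w $ j)" if "k < 2 * g" for k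
    using that assms by (simp add: scalar_prod_def)
  have ij: "i < 2 * g" "g + i < 2 * g" using assms by auto
  have "(?J *\<^sub>v w) $ i = (\<Sum>j\<in>{0..<2 * g}. if j = g + i then w $ j else 0)"
    unfolding *[OF ij(1)] using assms by (intro sum.cong) (auto simp: symplectic_form_def)
  then show "(?J *\<^sub>v w) $ i = w $ (g + i)" using assms by simp
  have "(?J *\<^sub>v w) $ (g + i) = (\<Sum>j\<in>{0..<2 * g}. if j = i then - w $ j else 0)"
    unfolding *[OF ij(2)] using assms by (intro sum.cong) (auto simp: symplectic_form_def)
  then show "(?J *\<^sub>v w) $ (g + i) = - w $ i" using assms by simp
qed

lemma symp_eq_scalar_prod:
  assumes "v \<in> vecs g" "w \<in> vecs g"
  shows "v \<bullet> (symplectic_form g *\<^sub>v w) = symp g v w"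
  using assms by (simp add: scalar_prod_def[of v] sum_lessThan_double symp_def
      symplectic_form_mult_vec del: index_mult_mat_vec)

lemma transpose_form_scalar_prod:
  fixes A :: "'a :: comm_ring_1 mat"
  assumes A: "A \<in> carrier_mat (2 * g) (2 * g)" and v: "v \<in> vecs g" and w: "w \<in> vecs g"
  shows "v \<bullet> ((transpose_mat A * symplectic_form g * A) *\<^sub>v w) = symp g (A *\<^sub>v v) (A *\<^sub>v w)"
proof -
  let ?J = "symplectic_form g :: 'a mat"
  have At: "transpose_mat A \<in> carrier_mat (2 * g) (2 * g)" using A by simp
  have x: "?J *\<^sub>v (A *\<^sub>v w) \<in> vecs g" using A w by (metis mult_mat_vec_carrier symplectic_form_carrier)
  have "(transpose_mat A * ?J * A) *\<^sub>v w = transpose_mat A *\<^sub>v (?J *\<^sub>v (A *\<^sub>v w))"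
    using assoc_mult_mat_vec[OF mult_carrier_mat[OF At symplectic_form_carrier] A w]
      assoc_mult_mat_vec[OF At symplectic_form_carrier, of "A *\<^sub>v w"] A w by simp
  then have "v \<bullet> ((transpose_mat A * ?J * A) *\<^sub>v w) = (A *\<^sub>v v) \<bullet> (?J *\<^sub>v (A *\<^sub>v w))"
    using transpose_vec_mult_scalar[OF A v x] At x v A
    by (metis comm_scalar_prod mult_mat_vec_carrier)
  then show ?thesis using symp_eq_scalar_prod A v w by (metis mult_mat_vec_carrier)
qed

text \<open>A matrix is recovered from its bilinear form by inserting unit vectors, so the matrix
  identity amounts to invariance of the form. From here on membership is checked on vectors.\<close>

lemma carrier_Sp_iff:
  fixes A :: "'a :: comm_ring_1 mat"
  shows "A \<in> carrier (Sp TYPE('a) g) \<longleftrightarrow> A \<in> carrier_mat (2 * g) (2 * g) \<and>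
     (\<forall>v\<in>vecs g. \<forall>w\<in>vecs g. symp g (A *\<^sub>v v) (A *\<^sub>v w) = symp g v w)" (is "_ \<longleftrightarrow> ?A \<and> ?P")
proof -
  let ?J = "symplectic_form g :: 'a mat" and ?M = "transpose_mat A * symplectic_form g * A"
  have "?M = ?J \<longleftrightarrow> ?P" if A: ?A
  proof
    assume "?M = ?J"
    then show ?P using transpose_form_scalar_prod[OF A] symp_eq_scalar_prod by metis
  next
    assume P: ?P
    have M: "?M \<in> carrier_mat (2 * g) (2 * g)" using A by auto
    show "?M = ?J"
    proof (rule mat_eq_vecI[OF M symplectic_form_carrier])
      fix j assume j: "j < 2 * g"
      show "?M *\<^sub>v unit_vec (2 * g) j = ?J *\<^sub>v unit_vec (2 * g) j"
      proof (rule eq_vecI)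
        fix i assume "i < dim_vec (?J *\<^sub>v unit_vec (2 * g) j)"
        then have i: "i < 2 * g" using symplectic_form_carrier[of g] by (metis carrier_matD(1) dim_mult_mat_vec)
        have *: "(?M *\<^sub>v unit_vec (2 * g) j) \<in> vecs g" "(?J *\<^sub>v unit_vec (2 * g) j) \<in> vecs g"
          by (auto intro: mult_mat_vec_carrier[OF M] mult_mat_vec_carrier[OF symplectic_form_carrier])
        have "unit_vec (2 * g) i \<bullet> (?M *\<^sub>v unit_vec (2 * g) j) = unit_vec (2 * g) i \<bullet> (?J *\<^sub>v unit_vec (2 * g) j)"
          using P by (subst transpose_form_scalar_prod[OF A]) (auto simp: symp_eq_scalar_prod)
        then show "(?M *\<^sub>v unit_vec (2 * g) j) $ i = (?J *\<^sub>v unit_vec (2 * g) j) $ i"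
          using i * by (simp only: scalar_prod_left_unit)
      qed (use M symplectic_form_carrier in \<open>metis carrier_matD(1) dim_mult_mat_vec\<close>)
    qed
  qed
  then show ?thesis by (auto simp: Sp_def)
qed

lemma Sp_simps [simp]:
  "A \<otimes>\<^bsub>Sp ty g\<^esub> B = A * B" "\<one>\<^bsub>Sp ty g\<^esub> = 1\<^sub>m (2 * g)"
  by (simp_all add: Sp_def)

lemma Sp_carrier_mat: "A \<in> carrier (Sp ty g) \<Longrightarrow> A \<in> carrier_mat (2 * g) (2 * g)"
  by (simp add: Sp_def)

lemma Sp_mult_vec_closed [simp]: "A \<in> carrier (Sp ty g) \<Longrightarrow> v \<in> vecs g \<Longrightarrow> A *\<^sub>v v \<in> vecs g"
  by (auto dest!: Sp_carrier_mat)

lemma Sp_mult_mult_vec: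
  "A \<in> carrier (Sp ty g) \<Longrightarrow> B \<in> carrier (Sp ty g) \<Longrightarrow> v \<in> vecs g \<Longrightarrow> (A * B) *\<^sub>v v = A *\<^sub>v (B *\<^sub>v v)"
  by (intro assoc_mult_mat_vec[of _ "2 * g" "2 * g"]) (auto dest: Sp_carrier_mat)

lemma Sp_symp:
  fixes A :: "'a :: comm_ring_1 mat"
  shows "A \<in> carrier (Sp TYPE('a) g) \<Longrightarrow> v \<in> vecs g \<Longrightarrow> w \<in> vecs g \<Longrightarrow>
    symp g (A *\<^sub>v v) (A *\<^sub>v w) = symp g v w"
  using carrier_Sp_iff by blast

lemma Sp_mult_closed:
  fixes A :: "'a :: comm_ring_1 mat"
  shows "A \<in> carrier (Sp TYPE('a) g) \<Longrightarrow> B \<in> carrier (Sp TYPE('a) g) \<Longrightarrow> A * B \<in> carrier (Sp TYPE('a) g)"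
  using monoid.m_closed[OF group.is_monoid[OF group_Sp]] by (metis Sp_simps(1))

lemma Sp_inv_mult_vec:
  fixes A :: "'a :: comm_ring_1 mat"
  assumes A: "A \<in> carrier (Sp TYPE('a) g)" and v: "v \<in> vecs g"
  shows "inv\<^bsub>Sp TYPE('a) g\<^esub> A *\<^sub>v (A *\<^sub>v v) = v"
    and "A *\<^sub>v (inv\<^bsub>Sp TYPE('a) g\<^esub> A *\<^sub>v v) = v"
proof -
  interpret group "Sp TYPE('a) g" by (rule group_Sp)
  show "inv\<^bsub>Sp TYPE('a) g\<^esub> A *\<^sub>v (A *\<^sub>v v) = v"
    using l_inv[OF A] Sp_mult_mult_vec[OF inv_closed[OF A] A v] v by simp
  show "A *\<^sub>v (inv\<^bsub>Sp TYPE('a) g\<^esub> A *\<^sub>v v) = v"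
    using r_inv[OF A] Sp_mult_mult_vec[OF A inv_closed[OF A] v] v by simp
qed

lemma Sp_inv_mult_cancel:
  fixes A :: "'a :: comm_ring_1 mat"
  assumes "A \<in> carrier (Sp TYPE('a) g)" "B \<in> carrier (Sp TYPE('a) g)"
  shows "inv\<^bsub>Sp TYPE('a) g\<^esub> A * (A * B) = B"
proof -
  interpret group "Sp TYPE('a) g" by (rule group_Sp)
  show ?thesis using assms m_assoc[of "inv\<^bsub>Sp TYPE('a) g\<^esub> A" A B] l_inv[of A] l_one[of B] by simp
qed

text \<open>The two cross terms cancel by antisymmetry, and the term quadratic in \<open>u\<close>
  vanishes because \<open>symp g u u = 0\<close>.\<close>

lemma transvection_in_Sp:
  fixes u :: "'a :: comm_ring_1 vec"
  assumes u: "u \<in> vecs g"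
  shows "transvection g u \<in> carrier (Sp TYPE('a) g)"
  unfolding carrier_Sp_iff
proof (intro conjI ballI)
  fix v w :: "'a vec" assume v: "v \<in> vecs g" and w: "w \<in> vecs g"
  show "symp g (transvection g u *\<^sub>v v) (transvection g u *\<^sub>v w) = symp g v w"
    using u v w symp_swap[of g u v]
    by (simp add: transvection_mult_vec symp_add_left symp_add_right symp_smult_left
        symp_smult_right algebra_simps)
qed simp

lemma mult_mat_vec_smult:
  fixes A :: "'a :: comm_ring_1 mat"
  shows "A \<in> carrier_mat n m \<Longrightarrow> v \<in> carrier_vec m \<Longrightarrow> A *\<^sub>v (c \<cdot>\<^sub>v v) = c \<cdot>\<^sub>v (A *\<^sub>v v)"
  by (intro eq_vecI) auto

text \<open>An isometry carries the functional \<open>symp g u\<close> to that of the image of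
  \<open>u\<close>, so conjugation by \<open>A\<close> moves the transvection along with its vector.
  The form without inverses is easier to apply.\<close>

lemma Sp_conj_transvection:
  fixes A :: "'a :: comm_ring_1 mat"
  assumes A: "A \<in> carrier (Sp TYPE('a) g)" and u: "u \<in> vecs g"
  shows "A * transvection g u = transvection g (A *\<^sub>v u) * A"
proof (rule mat_eq_vecI[of _ "2 * g" "2 * g"])
  fix j :: nat
  let ?w = "unit_vec (2 * g) j :: 'a vec"
  have w: "?w \<in> vecs g" by simp
  have Am: "A \<in> carrier_mat (2 * g) (2 * g)" using A by (rule Sp_carrier_mat)
  have "(A * transvection g u) *\<^sub>v ?w = A *\<^sub>v (?w + symp g u ?w \<cdot>\<^sub>v u)"
    using Sp_mult_mult_vec[OF A transvection_in_Sp[OF u] w] transvection_mult_vec[OF u w] by simp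
  also have "\<dots> = A *\<^sub>v ?w + symp g u ?w \<cdot>\<^sub>v (A *\<^sub>v u)"
    using mult_add_distrib_mat_vec[OF Am w, of "symp g u ?w \<cdot>\<^sub>v u"] mult_mat_vec_smult[OF Am u] u by simp
  also have "\<dots> = (transvection g (A *\<^sub>v u) * A) *\<^sub>v ?w"
    using Sp_mult_mult_vec[OF transvection_in_Sp A w, of "A *\<^sub>v u"] A u w
    by (simp add: transvection_mult_vec Sp_symp)
  finally show "(A * transvection g u) *\<^sub>v ?w = (transvection g (A *\<^sub>v u) * A) *\<^sub>v ?w" .
qed (intro mult_carrier_mat[where n = "2 * g"] transvection_carrier Sp_carrier_mat[OF A])+

text \<open>The vector enters a transvection quadratically, so the scalar contributes
  \<open>c * c\<close>. In particular the sign of a vector is invisible.\<close>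

lemma transvection_smult_unit:
  assumes "c * c = 1" "u \<in> vecs g"
  shows "transvection g (c \<cdot>\<^sub>v u) = transvection g u"
proof (rule mat_eq_vecI[of _ "2 * g" "2 * g"])
  fix j
  show "transvection g (c \<cdot>\<^sub>v u) *\<^sub>v unit_vec (2 * g) j = transvection g u *\<^sub>v unit_vec (2 * g) j"
    using assms by (simp add: transvection_mult_vec symp_smult_left smult_smult_assoc mult.assoc)
      (metis mult.assoc mult.commute mult_1)
qed auto

section \<open>Generation by transvections\<close>

text \<open>The symplectic complement of the first \<open>k\<close> hyperbolic planes; the
  inductions over \<open>k\<close> split off one plane at a time.\<close>

definition supported :: "nat \<Rightarrow> nat \<Rightarrow> 'a :: comm_ring_1 vec set" where
  "supported g k = {v \<in> vecs g. \<forall>i<k. v $ i = 0 \<and> v $ (g + i) = 0}"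

text \<open>The first two families act inside single hyperbolic planes, and the differences couple
  two planes. Such short vectors allow an entrywise check of their effect on 0-1 vectors in
  \<open>basic_transvection_entries\<close>.\<close>

definition basic_vecs :: "nat \<Rightarrow> nat \<Rightarrow> int vec set" where
  "basic_vecs g k = ea g ` {k..<g} \<union> eb g ` {k..<g} \<union>
     {ea g i - ea g j |i j. i \<in> {k..<g} \<and> j \<in> {k..<g} \<and> i \<noteq> j}"

definition elementary :: "nat \<Rightarrow> nat \<Rightarrow> int mat set" where
  "elementary g k = generate (Sp TYPE(int) g) (transvection g ` basic_vecs g k)"

lemma basic_vecs_vecs: "u \<in> basic_vecs g k \<Longrightarrow> u \<in> vecs g"
  by (auto simp: basic_vecs_def)

lemma elementary_subgroup: "subgroup (elementary g k) (Sp TYPE(int) g)"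
  unfolding elementary_def
  by (rule group.generate_is_subgroup[OF group_Sp]) (auto intro!: transvection_in_Sp basic_vecs_vecs)

lemma elementary_Sp: "A \<in> elementary g k \<Longrightarrow> A \<in> carrier (Sp TYPE(int) g)"
  using subgroup.mem_carrier[OF elementary_subgroup] .

lemma elementary_mult: "A \<in> elementary g k \<Longrightarrow> B \<in> elementary g k \<Longrightarrow> A * B \<in> elementary g k"
  using subgroup.m_closed[OF elementary_subgroup] by (metis Sp_simps(1))

lemma elementary_inv: "A \<in> elementary g k \<Longrightarrow> inv\<^bsub>Sp TYPE(int) g\<^esub> A \<in> elementary g k"
  using subgroup.m_inv_closed[OF elementary_subgroup] .

lemma elementary_one: "1\<^sub>m (2 * g) \<in> elementary g k"
  using subgroup.one_closed[OF elementary_subgroup] by (metis Sp_simps(2))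

lemma elementary_transvection: "u \<in> basic_vecs g k \<Longrightarrow> transvection g u \<in> elementary g k"
  unfolding elementary_def by (intro generate.incl imageI)

section \<open>Orbits of integer vectors under the elementary subgroup\<close>

definition reach :: "nat \<Rightarrow> nat \<Rightarrow> int vec \<Rightarrow> int vec \<Rightarrow> bool" where
  "reach g k v w \<longleftrightarrow> v \<in> vecs g \<and> (\<exists>A\<in>elementary g k. A *\<^sub>v v = w)"

lemma reach_refl: "v \<in> vecs g \<Longrightarrow> reach g k v v"
  unfolding reach_def by (auto intro!: bexI[OF _ elementary_one])

lemma reach_sym: "reach g k v w \<Longrightarrow> reach g k w v"
  unfolding reach_def using Sp_inv_mult_vec(1) elementary_inv elementary_Sp Sp_mult_vec_closed by metis

lemma reach_trans [trans]: "reach g k u v \<Longrightarrow> reach g k v w \<Longrightarrow> reach g k u w"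
  unfolding reach_def using elementary_mult elementary_Sp Sp_mult_mult_vec by metis

text \<open>This is the action of the \<open>c\<close>-th power: \<open>symp g u u = 0\<close> makes
  the coefficients add up. A negative exponent is treated by inverting the opposite power.\<close>

lemma elementary_transvection_power:
  assumes u: "u \<in> basic_vecs g k"
  shows "\<exists>A\<in>elementary g k. \<forall>w\<in>vecs g. A *\<^sub>v w = w + (c * symp g u w) \<cdot>\<^sub>v u"
proof -
  have uv: "u \<in> vecs g" using u by (rule basic_vecs_vecs)
  have nat: "\<exists>A\<in>elementary g k. \<forall>w\<in>vecs g. A *\<^sub>v w = w + (int n * symp g u w) \<cdot>\<^sub>v u" for n
  proof (induction n)
    case 0
    show ?case using elementary_one uv by (intro bexI[of _ "1\<^sub>m (2 * g)"]) (auto intro!: eq_vecI)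
  next
    case (Suc n)
    then obtain A where A: "A \<in> elementary g k"
      "\<And>w. w \<in> vecs g \<Longrightarrow> A *\<^sub>v w = w + (int n * symp g u w) \<cdot>\<^sub>v u"
      by auto
    have "(transvection g u * A) *\<^sub>v w = w + (int (Suc n) * symp g u w) \<cdot>\<^sub>v u" if w: "w \<in> vecs g" for w
    proof -
      have "(transvection g u * A) *\<^sub>v w = transvection g u *\<^sub>v (w + (int n * symp g u w) \<cdot>\<^sub>v u)"
        using Sp_mult_mult_vec[OF elementary_Sp[OF elementary_transvection[OF u]] elementary_Sp[OF A(1)] w] A(2)[OF w] by simp
      also have "\<dots> = w + (int (Suc n) * symp g u w) \<cdot>\<^sub>v u"
        using w uv by (subst transvection_mult_vec)
          (auto simp: symp_add_right symp_smult_right algebra_simps intro!: eq_vecI)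
      finally show ?thesis .
    qed
    then show ?case using elementary_mult[OF elementary_transvection[OF u] A(1)] by blast
  qed
  show ?thesis
  proof (cases "c \<ge> 0")
    case True
    then show ?thesis using nat[of "nat c"] by simp
  next
    case False
    then obtain A where A: "A \<in> elementary g k"
      "\<And>w. w \<in> vecs g \<Longrightarrow> A *\<^sub>v w = w + (- c * symp g u w) \<cdot>\<^sub>v u"
      using nat[of "nat (- c)"] by auto
    have "inv\<^bsub>Sp TYPE(int) g\<^esub> A *\<^sub>v w = w + (c * symp g u w) \<cdot>\<^sub>v u" if w: "w \<in> vecs g" for w
    proof -
      let ?w = "w + (c * symp g u w) \<cdot>\<^sub>v u"
      have "?w \<in> vecs g" using w uv by simp
      moreover have "A *\<^sub>v ?w = w"
        using w uv by (subst A(2))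
          (auto simp: symp_add_right symp_smult_right algebra_simps intro!: eq_vecI)
      ultimately show ?thesis using Sp_inv_mult_vec(1)[OF elementary_Sp[OF A(1)]] by metis
    qed
    then show ?thesis using elementary_inv[OF A(1)] by blast
  qed
qed

lemma reach_transvection:
  assumes "u \<in> basic_vecs g k" "v \<in> vecs g"
  shows "reach g k v (v + (c * symp g u v) \<cdot>\<^sub>v u)"
  using elementary_transvection_power[OF assms(1)] assms(2) unfolding reach_def by meson

text \<open>Splitting a vector into its two coordinate functions turns the action of the generators
  into function updates.\<close>

definition vec2 :: "nat \<Rightarrow> (nat \<Rightarrow> 'a) \<Rightarrow> (nat \<Rightarrow> 'a) \<Rightarrow> 'a :: comm_ring_1 vec" where
  "vec2 g x y = vec (2 * g) (\<lambda>i. if i < g then x i else y (i - g))"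

lemma vec2_carrier [simp]: "vec2 g x y \<in> vecs g"
  by (simp add: vec2_def)

lemma vec2_nth [simp]: "i < g \<Longrightarrow> vec2 g x y $ i = x i" "i < g \<Longrightarrow> vec2 g x y $ (g + i) = y i"
  by (simp_all add: vec2_def)

lemma vec2_eta: "v \<in> vecs g \<Longrightarrow> vec2 g (($) v) (\<lambda>i. v $ (g + i)) = v"
  by (rule vec_eq_halvesI) auto

lemma reach_add_x:
  assumes "k \<le> i" "i < g"
  shows "reach g k (vec2 g x y) (vec2 g (x(i := x i + c * y i)) y)"
proof -
  have "ea g i \<in> basic_vecs g k" using assms by (auto simp: basic_vecs_def)
  from reach_transvection[OF this, of "vec2 g x y" c] show ?thesis
    using assms by (auto elim!: back_subst[of "reach g k (vec2 g x y)"] intro!: vec_eq_halvesI[where g = g])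
qed

lemma reach_add_y:
  assumes "k \<le> i" "i < g"
  shows "reach g k (vec2 g x y) (vec2 g x (y(i := y i + c * x i)))"
proof -
  have "eb g i \<in> basic_vecs g k" using assms by (auto simp: basic_vecs_def)
  from reach_transvection[OF this, of "vec2 g x y" "- c"] show ?thesis
    using assms by (auto elim!: back_subst[of "reach g k (vec2 g x y)"] intro!: vec_eq_halvesI[where g = g])
qed

lemma reach_add_diff:
  assumes "k \<le> i" "i < g" "k \<le> j" "j < g" "i \<noteq> j"
  shows "reach g k (vec2 g x y)
    (vec2 g (x(i := x i + c * (y i - y j), j := x j - c * (y i - y j))) y)"
proof -
  have "ea g i - ea g j \<in> basic_vecs g k" using assms unfolding basic_vecs_def by auto
  from reach_transvection[OF this, of "vec2 g x y" c] show ?thesis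
    using assms by (auto simp: symp_diff_left elim!: back_subst[of "reach g k (vec2 g x y)"] intro!: vec_eq_halvesI[where g = g])
qed

text \<open>Three alternating unit shears of a plane multiply to a quarter turn.\<close>

lemma reach_rotate:
  assumes i: "k \<le> i" "i < g"
  shows "reach g k (vec2 g x y) (vec2 g (x(i := y i)) (y(i := - x i)))"
proof -
  have "reach g k (vec2 g x y) (vec2 g (x(i := x i + y i)) y)"
    using reach_add_x[OF i, of x y 1] by simp
  also have "reach g k \<dots> (vec2 g (x(i := x i + y i)) (y(i := - x i)))"
    using reach_add_y[OF i, of "x(i := x i + y i)" y "- 1"] by simp
  also have "reach g k \<dots> (vec2 g (x(i := y i)) (y(i := - x i)))"
    using reach_add_x[OF i, of "x(i := x i + y i)" "y(i := - x i)" 1] by simp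
  finally show ?thesis .
qed

text \<open>The transvection along \<open>ea g i - ea g j\<close> corresponds to the square of
  \<open>y i - y j\<close>. Transvections along \<open>ea g i\<close> and \<open>ea g j\<close>
  remove the two pure squares, and the mixed term remains.\<close>

lemma reach_shear:
  assumes i: "k \<le> i" "i < g" and j: "k \<le> j" "j < g" and "i \<noteq> j"
  shows "reach g k (vec2 g x y) (vec2 g (x(i := x i + c * y j, j := x j + c * y i)) y)"
proof -
  let ?x = "x(i := x i - c * (y i - y j), j := x j + c * (y i - y j))"
  have "reach g k (vec2 g x y) (vec2 g ?x y)"
    using reach_add_diff[OF i j \<open>i \<noteq> j\<close>, of x y "- c"] by simp
  also have "reach g k \<dots> (vec2 g (?x(i := ?x i + c * y i)) y)"
    by (rule reach_add_x[OF i])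
  also have "reach g k \<dots> (vec2 g (?x(i := ?x i + c * y i, j := (?x(i := ?x i + c * y i)) j + c * y j)) y)"
    by (rule reach_add_x[OF j])
  also have "?x(i := ?x i + c * y i, j := (?x(i := ?x i + c * y i)) j + c * y j)
     = x(i := x i + c * y j, j := x j + c * y i)"
    using \<open>i \<noteq> j\<close> by (auto simp: fun_eq_iff algebra_simps)
  finally show ?thesis .
qed

text \<open>A quarter turn in plane \<open>j\<close> moves \<open>x j\<close> among the
  \<open>y\<close> coordinates, where the shear adds it to \<open>x i\<close>; turning back restores
  plane \<open>j\<close>. As \<open>y i = 0\<close>, the shear leaves the other coordinate
  alone.\<close>

lemma reach_add_multiple:
  assumes i: "k \<le> i" "i < g" and j: "k \<le> j" "j < g" and "i \<noteq> j" and y: "y i = 0" "y j = 0"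
  shows "reach g k (vec2 g x y) (vec2 g (x(i := x i + c * x j)) y)"
proof -
  have rot: "reach g k (vec2 g x y) (vec2 g (x(j := 0)) (y(j := - x j)))" for x
    using reach_rotate[OF j, of x y] y by simp
  have "reach g k (vec2 g x y) (vec2 g (x(j := 0)) (y(j := - x j)))"
    by (rule rot)
  also have "reach g k \<dots> (vec2 g (x(i := x i + c * x j, j := 0)) (y(j := - x j)))"
    using reach_shear[OF i j \<open>i \<noteq> j\<close>, of "x(j := 0)" "y(j := - x j)" "- c"] y \<open>i \<noteq> j\<close>
    by (simp add: fun_upd_twist)
  also have "reach g k \<dots> (vec2 g (x(i := x i + c * x j)) y)"
    using reach_sym[OF rot[of "x(i := x i + c * x j)"]] \<open>i \<noteq> j\<close> by (simp add: fun_upd_twist)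
  finally show ?thesis .
qed

lemma reach_swap:
  assumes i: "k \<le> i" "i < g" and j: "k \<le> j" "j < g" and "i \<noteq> j" and y: "y i = 0" "y j = 0"
  shows "reach g k (vec2 g x y) (vec2 g (x(i := x j, j := - x i)) y)"
proof -
  have "reach g k (vec2 g x y) (vec2 g (x(i := x i + x j)) y)"
    using reach_add_multiple[where c = 1, OF i j \<open>i \<noteq> j\<close>, of y x] y by simp
  also have "reach g k \<dots> (vec2 g (x(i := x i + x j, j := - x i)) y)"
    using reach_add_multiple[where c = "- 1", OF j i, of y "x(i := x i + x j)"] y \<open>i \<noteq> j\<close> by simp
  also have "reach g k \<dots> (vec2 g (x(i := x j, j := - x i)) y)"
    using reach_add_multiple[where c = 1, OF i j \<open>i \<noteq> j\<close>, of y "x(i := x i + x j, j := - x i)"] y \<open>i \<noteq> j\<close>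
    by (simp add: fun_upd_twist)
  finally show ?thesis .
qed

text \<open>Euclidean algorithm inside each hyperbolic plane: \<open>x i\<close> is reduced modulo
  \<open>y i\<close>, and a quarter turn puts the remainder, up to sign, in place of
  \<open>y i\<close>. The sum of the absolute values of \<open>y\<close> decreases.\<close>

lemma reach_isotropic:
  assumes "\<And>i. i < k \<Longrightarrow> x i = 0 \<and> y i = 0"
  shows "\<exists>x'. (\<forall>i<k. x' i = 0) \<and> reach g k (vec2 g x y) (vec2 g x' (\<lambda>_. 0))"
  using assms
proof (induction "\<Sum>i<g. nat \<bar>y i\<bar>" arbitrary: x y rule: less_induct)
  case less
  show ?case
  proof (cases "\<forall>i<g. y i = 0")
    case True
    then have "vec2 g x y = vec2 g x (\<lambda>_. 0)" by (intro vec_eq_halvesI[where g = g]) auto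
    then show ?thesis using less.prems reach_refl[of "vec2 g x y"] by (metis vec2_carrier)
  next
    case False
    then obtain i where i: "i < g" "y i \<noteq> 0" by auto
    then have ki: "k \<le> i" using less.prems not_le by blast
    let ?m = "x i mod y i"
    let ?x = "x(i := y i)" and ?y = "y(i := - ?m)"
    have "x(i := x i + - (x i div y i) * y i) = x(i := ?m)"
      by (simp add: minus_div_mult_eq_mod[symmetric])
    then have "reach g k (vec2 g x y) (vec2 g (x(i := ?m)) y)"
      using reach_add_x[OF ki i(1), of x y "- (x i div y i)"] by metis
    also have "reach g k \<dots> (vec2 g ?x ?y)"
      using reach_rotate[OF ki i(1), of "x(i := ?m)" y] by simp
    finally have 1: "reach g k (vec2 g x y) (vec2 g ?x ?y)" .
    have "(\<Sum>j<g. nat \<bar>?y j\<bar>) < (\<Sum>j<g. nat \<bar>y j\<bar>)"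
    proof (rule sum_strict_mono_ex1)
      show "\<forall>j\<in>{..<g}. nat \<bar>?y j\<bar> \<le> nat \<bar>y j\<bar>"
        using abs_mod_less[OF i(2), of "x i"] by auto
      show "\<exists>j\<in>{..<g}. nat \<bar>?y j\<bar> < nat \<bar>y j\<bar>"
        using abs_mod_less[OF i(2), of "x i"] i by (intro bexI[of _ i]) auto
    qed simp
    then obtain x' where "\<forall>i<k. x' i = 0" "reach g k (vec2 g ?x ?y) (vec2 g x' (\<lambda>_. 0))"
      using less.hyps[of ?y ?x] less.prems ki by (metis fun_upd_other not_le)
    then show ?thesis using reach_trans[OF 1] by auto
  qed
qed

text \<open>Euclidean algorithm again, now between \<open>x k\<close> and the later coordinates. The
  measure leaves out position \<open>k\<close>, where the common divisor accumulates.\<close>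

lemma reach_single:
  assumes k: "k < g" and "\<And>i. i < k \<Longrightarrow> x i = 0"
  shows "\<exists>d. reach g k (vec2 g x (\<lambda>_. 0)) (d \<cdot>\<^sub>v ea g k)"
  using assms(2)
proof (induction "\<Sum>i\<in>{k<..<g}. nat \<bar>x i\<bar>" arbitrary: x rule: less_induct)
  case less
  show ?case
  proof (cases "\<forall>i\<in>{k<..<g}. x i = 0")
    case True
    then have "i \<noteq> k \<Longrightarrow> i < g \<Longrightarrow> x i = 0" for i using less.prems by (cases "i < k") auto
    then have "vec2 g x (\<lambda>_. 0) = x k \<cdot>\<^sub>v ea g k"
      using k by (intro vec_eq_halvesI[where g = g]) auto
    then show ?thesis using reach_refl[of "vec2 g x (\<lambda>_. 0)"] by (metis vec2_carrier)
  next
    case False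
    then obtain i where i: "k < i" "i < g" "x i \<noteq> 0" by auto
    let ?m = "x k mod x i" and ?y = "\<lambda>_. 0 :: int"
    let ?x = "x(k := x i, i := - ?m)"
    have "x(k := x k + - (x k div x i) * x i) = x(k := ?m)"
      by (simp add: minus_div_mult_eq_mod[symmetric])
    then have "reach g k (vec2 g x ?y) (vec2 g (x(k := ?m)) ?y)"
      using reach_add_multiple[of k k g i ?y x "- (x k div x i)"] k i by (metis less_imp_le order_refl less_irrefl)
    also have "reach g k \<dots> (vec2 g ?x ?y)"
      using reach_swap[of k k g i ?y "x(k := ?m)"] k i by simp
    finally have 1: "reach g k (vec2 g x ?y) (vec2 g ?x ?y)" .
    have "(\<Sum>j\<in>{k<..<g}. nat \<bar>?x j\<bar>) < (\<Sum>j\<in>{k<..<g}. nat \<bar>x j\<bar>)"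
    proof (rule sum_strict_mono_ex1)
      show "\<forall>j\<in>{k<..<g}. nat \<bar>?x j\<bar> \<le> nat \<bar>x j\<bar>"
        using abs_mod_less[OF i(3), of "x k"] by auto
      show "\<exists>j\<in>{k<..<g}. nat \<bar>?x j\<bar> < nat \<bar>x j\<bar>"
        using abs_mod_less[OF i(3), of "x k"] i by (intro bexI[of _ i]) auto
    qed simp
    then obtain d where "reach g k (vec2 g ?x ?y) (d \<cdot>\<^sub>v ea g k)"
      using less.hyps[of ?x] less.prems i by fastforce
    then show ?thesis using reach_trans[OF 1] by auto
  qed
qed

lemma reach_multiple_of_basis:
  assumes k: "k < g" and v: "v \<in> supported g k"
  shows "\<exists>d. reach g k v (d \<cdot>\<^sub>v ea g k)"
proof -
  have vv: "v \<in> vecs g" "\<And>i. i < k \<Longrightarrow> v $ i = 0 \<and> v $ (g + i) = 0"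
    using v by (auto simp: supported_def)
  obtain x where "\<forall>i<k. x i = 0" "reach g k v (vec2 g x (\<lambda>_. 0))"
    using reach_isotropic[of k "($) v" "\<lambda>i. v $ (g + i)" g] vv by (auto simp: vec2_eta)
  then show ?thesis using reach_single[OF k, of x] reach_trans by blast
qed

lemma supported_vecs: "v \<in> supported g k \<Longrightarrow> v \<in> vecs g"
  by (simp add: supported_def)

lemma ea_supported [simp]: "k \<le> i \<Longrightarrow> i < g \<Longrightarrow> ea g i \<in> supported g k"
  and eb_supported [simp]: "k \<le> i \<Longrightarrow> i < g \<Longrightarrow> eb g i \<in> supported g k"
  by (auto simp: supported_def)

text \<open>By quadratic dependence on the vector, this is the power with exponent
  \<open>d * d\<close> of the transvection along \<open>ea g k\<close>.\<close>

lemma elementary_transvection_multiple: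
  assumes k: "k < g"
  shows "transvection g (d \<cdot>\<^sub>v ea g k) \<in> elementary g k"
proof -
  let ?e = "ea g k :: int vec"
  have e: "?e \<in> basic_vecs g k" using k by (auto simp: basic_vecs_def)
  obtain A where A: "A \<in> elementary g k"
    "\<And>w. w \<in> vecs g \<Longrightarrow> A *\<^sub>v w = w + (d * d * symp g ?e w) \<cdot>\<^sub>v ?e"
    using elementary_transvection_power[OF e, of "d * d"] by blast
  have "A = transvection g (d \<cdot>\<^sub>v ?e)"
    using Sp_carrier_mat[OF elementary_Sp[OF A(1)]] k
    by (intro mat_eq_vecI[of _ "2 * g" "2 * g"])
      (simp_all add: A(2) transvection_mult_vec symp_smult_left smult_smult_assoc mult.left_commute)
  then show ?thesis using A(1) by simp
qed

text \<open>An elementary matrix moves \<open>z\<close> to a multiple of \<open>ea g k\<close>;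
  conjugating by it reduces to \<open>elementary_transvection_multiple\<close>.\<close>

lemma elementary_transvection_supported:
  assumes k: "k < g" and z: "z \<in> supported g k"
  shows "transvection g z \<in> elementary g k"
proof -
  obtain A d where A: "A \<in> elementary g k" "A *\<^sub>v z = d \<cdot>\<^sub>v ea g k"
    using reach_multiple_of_basis[OF k z] unfolding reach_def by auto
  have zv: "z \<in> vecs g" using z by (rule supported_vecs)
  have T: "transvection g z \<in> carrier (Sp TYPE(int) g)" by (rule transvection_in_Sp[OF zv])
  have "A * transvection g z = transvection g (d \<cdot>\<^sub>v ea g k) * A"
    using Sp_conj_transvection[OF elementary_Sp[OF A(1)] zv] A(2) by simp
  then have "A * transvection g z \<in> elementary g k"
    using elementary_mult[OF elementary_transvection_multiple[OF k] A(1)] by simp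
  then have "inv\<^bsub>Sp TYPE(int) g\<^esub> A * (A * transvection g z) \<in> elementary g k"
    by (rule elementary_mult[OF elementary_inv[OF A(1)]])
  then show ?thesis
    by (simp add: Sp_inv_mult_cancel[OF elementary_Sp[OF A(1)] T])
qed

text \<open>Two quarter turns in plane \<open>k\<close> give the sign change.\<close>

lemma reach_minus_basis:
  assumes k: "k < g"
  shows "reach g k (- 1 \<cdot>\<^sub>v ea g k) (ea g k)"
proof -
  let ?x = "(\<lambda>_. 0)(k := - 1 :: int)" and ?y = "\<lambda>_. 0 :: int"
  have "reach g k (vec2 g ?x ?y) (vec2 g ?y (?y(k := 1)))"
    using reach_rotate[of k k g ?x ?y] k by (simp add: fun_upd_idem)
  also have "reach g k \<dots> (vec2 g (?y(k := 1)) ?y)"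
    using reach_rotate[of k k g ?y "?y(k := 1)"] k by (simp add: fun_upd_idem)
  also have "vec2 g ?x ?y = - 1 \<cdot>\<^sub>v ea g k"
    using k by (intro vec_eq_halvesI[where g = g]) auto
  also have "vec2 g (?y(k := 1)) ?y = ea g k"
    using k by (intro vec_eq_halvesI[where g = g]) auto
  finally show ?thesis .
qed

section \<open>Stabilizers of the first hyperbolic pairs\<close>

definition stab :: "nat \<Rightarrow> nat \<Rightarrow> 'a :: comm_ring_1 mat set" where
  "stab g k = {A \<in> carrier (Sp TYPE('a) g). \<forall>i<k. A *\<^sub>v ea g i = ea g i \<and> A *\<^sub>v eb g i = eb g i}"

lemma stab_Sp: "A \<in> stab g k \<Longrightarrow> A \<in> carrier (Sp TYPE('a :: comm_ring_1) g)"
  by (simp add: stab_def)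

lemma stab_0: "stab g 0 = carrier (Sp TYPE('a :: comm_ring_1) g)"
  by (simp add: stab_def)

lemma stab_subgroup:
  assumes "k \<le> g"
  shows "subgroup (stab g k) (Sp TYPE('a :: comm_ring_1) g)"
proof -
  interpret S: group "Sp TYPE('a) g" by (rule group_Sp)
  show ?thesis
  proof (rule S.subgroupI)
    have "\<one>\<^bsub>Sp TYPE('a) g\<^esub> \<in> stab g k" using S.one_closed by (auto simp: stab_def)
    then show "(stab g k :: 'a mat set) \<noteq> {}" by blast
  next
    fix A :: "'a mat" assume A: "A \<in> stab g k"
    have "inv\<^bsub>Sp TYPE('a) g\<^esub> A *\<^sub>v ea g i = ea g i" "inv\<^bsub>Sp TYPE('a) g\<^esub> A *\<^sub>v eb g i = eb g i"
      if "i < k" for i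
      using Sp_inv_mult_vec(1)[OF stab_Sp[OF A], of "ea g i"] Sp_inv_mult_vec(1)[OF stab_Sp[OF A], of "eb g i"]
        A that by (simp_all add: stab_def)
    then show "inv\<^bsub>Sp TYPE('a) g\<^esub> A \<in> stab g k"
      using S.inv_closed[OF stab_Sp[OF A]] by (simp add: stab_def)
  next
    fix A B :: "'a mat" assume "A \<in> stab g k" "B \<in> stab g k"
    then show "A \<otimes>\<^bsub>Sp TYPE('a) g\<^esub> B \<in> stab g k"
      using Sp_mult_closed[of A g B] by (auto simp: stab_def Sp_mult_mult_vec)
  qed (auto simp: stab_def)
qed

lemma stab_full: "stab g g = {1\<^sub>m (2 * g) :: 'a :: comm_ring_1 mat}"
proof -
  have "A = 1\<^sub>m (2 * g)" if A: "A \<in> stab g g" for A :: "'a mat"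
  proof (rule mat_eq_vecI[of _ "2 * g" "2 * g"])
    fix j assume j: "j < 2 * g"
    show "A *\<^sub>v unit_vec (2 * g) j = 1\<^sub>m (2 * g) *\<^sub>v unit_vec (2 * g) j"
    proof (cases "j < g")
      case False
      then have "j - g < g" "g + (j - g) = j" using j by auto
      then show ?thesis using A by (auto simp: stab_def)
    qed (use A in \<open>simp add: stab_def\<close>)
  qed (use A Sp_carrier_mat in \<open>auto simp: stab_def\<close>)
  moreover have "1\<^sub>m (2 * g) \<in> (stab g g :: 'a mat set)"
    using subgroup.one_closed[OF stab_subgroup[of g g]] by simp
  ultimately show ?thesis by blast
qed

text \<open>The coordinates in the first \<open>k\<close> planes are, up to sign, pairings with
  basis vectors that \<open>A\<close> fixes.\<close>

lemma stab_image_supported: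
  fixes A :: "'a :: comm_ring_1 mat"
  assumes A: "A \<in> stab g k" and v: "v \<in> supported g k" and "k \<le> g"
  shows "A *\<^sub>v v \<in> supported g k"
proof -
  have AS: "A \<in> carrier (Sp TYPE('a) g)" using A by (rule stab_Sp)
  have vv: "v \<in> vecs g" using v by (rule supported_vecs)
  have "(A *\<^sub>v v) $ i = 0 \<and> (A *\<^sub>v v) $ (g + i) = 0" if i: "i < k" for i
  proof -
    have ig: "i < g" using i \<open>k \<le> g\<close> by simp
    have "symp g (A *\<^sub>v ea g i) (A *\<^sub>v v) = 0" "symp g (A *\<^sub>v eb g i) (A *\<^sub>v v) = 0"
      using v i ig by (simp_all add: Sp_symp[OF AS _ vv] supported_def)
    then show ?thesis using A i ig by (simp add: stab_def)
  qed
  then show ?thesis using AS vv by (simp add: supported_def)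
qed

lemma basic_vecs_orthogonal:
  assumes "u \<in> basic_vecs g k" "i < k" "k \<le> g"
  shows "symp g u (ea g i) = 0" "symp g u (eb g i) = 0"
  using assms by (auto simp: basic_vecs_def symp_diff_left)

lemma elementary_stab:
  assumes k: "k \<le> g"
  shows "elementary g k \<subseteq> stab g k"
  unfolding elementary_def
proof (rule group.generate_subgroup_incl[OF group_Sp _ stab_subgroup[OF k]])
  have "transvection g u \<in> stab g k" if u: "u \<in> basic_vecs g k" for u
  proof -
    have uv: "u \<in> vecs g" using u by (rule basic_vecs_vecs)
    have "transvection g u *\<^sub>v ea g i = ea g i" "transvection g u *\<^sub>v eb g i = eb g i" if "i < k" for i
      using basic_vecs_orthogonal[OF u that k] uv by (auto simp: transvection_mult_vec intro!: eq_vecI)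
    then show ?thesis using transvection_in_Sp[OF uv] by (auto simp: stab_def)
  qed
  then show "transvection g ` basic_vecs g k \<subseteq> stab g k" by auto
qed

text \<open>After \<open>v\<close> has been moved to \<open>ea g k\<close>, two transvections fixing
  \<open>ea g k\<close> bring the partner to \<open>eb g k\<close>; the last one is along the
  difference between the current and the desired partner.\<close>

lemma elementary_to_basis_pair:
  assumes k: "k < g" and v: "v \<in> supported g k" and u: "u \<in> supported g k" and vu: "symp g v u = 1"
  shows "\<exists>A\<in>elementary g k. A *\<^sub>v v = ea g k \<and> A *\<^sub>v u = eb g k"
proof -
  have vv: "v \<in> vecs g" and uv: "u \<in> vecs g" using v u by (auto intro: supported_vecs)
  have "reach g k v (ea g k)"
  proof -
    obtain d where d: "reach g k v (d \<cdot>\<^sub>v ea g k)"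
      using reach_multiple_of_basis[OF k v] by auto
    then obtain A where A: "A \<in> elementary g k" "A *\<^sub>v v = d \<cdot>\<^sub>v ea g k" unfolding reach_def by auto
    \<comment> \<open>\<open>A\<close> preserves the pairing 1 of \<open>v\<close> with
      \<open>u\<close>, so \<open>d\<close> divides 1.\<close>
    have "d * (A *\<^sub>v u) $ (g + k) = 1"
      using Sp_symp[OF elementary_Sp[OF A(1)] vv uv] A(2) vu k by (simp add: symp_smult_left)
    then have "d = 1 \<or> d = - 1" by (metis dvd_triv_left zdvd1_eq abs_eq_iff abs_one)
    then show ?thesis using d reach_trans[OF _ reach_minus_basis[OF k]] by auto
  qed
  then obtain A where A: "A \<in> elementary g k" "A *\<^sub>v v = ea g k" unfolding reach_def by auto
  define u1 where "u1 = A *\<^sub>v u"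
  have u1: "u1 \<in> supported g k" "u1 \<in> vecs g"
    using stab_image_supported[OF subsetD[OF elementary_stab A(1)] u] k supported_vecs by (auto simp: u1_def)
  have u1k: "u1 $ (g + k) = 1"
    using Sp_symp[OF elementary_Sp[OF A(1)] vv uv] A(2) vu k by (simp add: u1_def)
  have "ea g k \<in> basic_vecs g k" using k by (auto simp: basic_vecs_def)
  \<comment> \<open>The exponent makes entry \<open>k\<close> of the partner equal to - 1, which is
    exactly what gives the next transvection the coefficient
    \<open>symp g z u2 = - 1\<close>.\<close>
  from elementary_transvection_power[OF this, of "- 1 - u1 $ k"] obtain B where B: "B \<in> elementary g k"
    "\<And>w. w \<in> vecs g \<Longrightarrow> B *\<^sub>v w = w + ((- 1 - u1 $ k) * symp g (ea g k) w) \<cdot>\<^sub>v ea g k" by blast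
  have Be: "B *\<^sub>v ea g k = ea g k" using k by (subst B(2)) (auto intro!: eq_vecI)
  define u2 where "u2 = B *\<^sub>v u1"
  have u2: "u2 \<in> supported g k" "u2 \<in> vecs g"
    using stab_image_supported[OF subsetD[OF elementary_stab B(1)] u1(1)] k supported_vecs by (auto simp: u2_def)
  have u2k: "u2 $ (g + k) = 1" "u2 $ k = - 1"
    using B(2)[OF u1(2)] u1k u1(2) k by (auto simp: u2_def)
  define z where "z = u2 - eb g k"
  have z: "z \<in> supported g k" "z \<in> vecs g"
    using u2 k by (auto simp: z_def supported_def)
  have Cz: "transvection g z \<in> elementary g k" by (rule elementary_transvection_supported[OF k z(1)])
  \<comment> \<open>Both \<open>u2\<close> and \<open>eb g k\<close> pair to 1 with
    \<open>ea g k\<close>, so their difference \<open>z\<close> is orthogonal to it.\<close>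
  have "transvection g z *\<^sub>v ea g k = ea g k"
    using z u2 u2k k by (subst transvection_mult_vec) (auto simp: z_def intro!: eq_vecI)
  moreover have "transvection g z *\<^sub>v u2 = eb g k"
  proof -
    have "symp g z u2 = - 1" unfolding z_def using u2 u2k k by (subst symp_diff_left) auto
    then show ?thesis
      using z u2 k by (subst transvection_mult_vec) (auto simp: z_def intro!: eq_vecI)
  qed
  ultimately have "(transvection g z * (B * A)) *\<^sub>v v = ea g k" "(transvection g z * (B * A)) *\<^sub>v u = eb g k"
    using A(2) Be vv uv elementary_Sp[OF A(1)] elementary_Sp[OF B(1)] elementary_Sp[OF Cz]
    by (simp_all add: Sp_mult_mult_vec[where g = g and ty = "TYPE(int)"] Sp_mult_closed u1_def u2_def)
  then show ?thesis using elementary_mult[OF Cz elementary_mult[OF B(1) A(1)]] by blast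
qed

lemma elementary_from_basis_pair:
  assumes k: "k < g" and v: "v \<in> supported g k" and u: "u \<in> supported g k" and vu: "symp g v u = 1"
  shows "\<exists>A\<in>elementary g k. A *\<^sub>v ea g k = v \<and> A *\<^sub>v eb g k = u"
proof -
  obtain A where A: "A \<in> elementary g k" "A *\<^sub>v v = ea g k" "A *\<^sub>v u = eb g k"
    using elementary_to_basis_pair[OF assms] by auto
  then have "inv\<^bsub>Sp TYPE(int) g\<^esub> A *\<^sub>v ea g k = v" "inv\<^bsub>Sp TYPE(int) g\<^esub> A *\<^sub>v eb g k = u"
    using Sp_inv_mult_vec(1)[OF elementary_Sp[OF A(1)]] supported_vecs[OF v] supported_vecs[OF u] by metis+
  then show ?thesis using elementary_inv[OF A(1)] by blast
qed

lemma basic_vecs_mono: "k \<le> l \<Longrightarrow> basic_vecs g l \<subseteq> basic_vecs g k"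
  unfolding basic_vecs_def by (intro Un_mono image_mono) (auto, metis le_trans)

lemma elementary_mono: "k \<le> l \<Longrightarrow> elementary g l \<subseteq> elementary g k"
  unfolding elementary_def
  by (intro group.mono_generate[OF group_Sp] image_mono basic_vecs_mono)

text \<open>Downward induction from the trivial stabilizer at \<open>k = g\<close>: an elementary
  matrix moves the images of the \<open>k\<close>-th pair back, and the product lies in the next
  smaller stabilizer.\<close>

lemma stab_eq_elementary:
  assumes "k \<le> g"
  shows "stab g k = elementary g k"
  using assms
proof (induction k rule: inc_induct)
  case base
  then show ?case using stab_full[where 'a = int] elementary_one[of g g] elementary_stab[of g g] by auto
next
  case (step k)
  have k: "k < g" using step by simp
  have "A \<in> elementary g k" if A: "A \<in> stab g k" for A
  proof -
    have AS: "A \<in> carrier (Sp TYPE(int) g)" using A by (rule stab_Sp)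
    have "A *\<^sub>v ea g k \<in> supported g k" "A *\<^sub>v eb g k \<in> supported g k"
      using stab_image_supported[OF A] k by auto
    moreover have "symp g (A *\<^sub>v ea g k) (A *\<^sub>v eb g k) = 1"
      using k by (simp add: Sp_symp[OF AS])
    ultimately obtain B where B: "B \<in> elementary g k" "B *\<^sub>v (A *\<^sub>v ea g k) = ea g k" "B *\<^sub>v (A *\<^sub>v eb g k) = eb g k"
      using elementary_to_basis_pair[OF k] by metis
    have BS: "B \<in> carrier (Sp TYPE(int) g)" using B(1) by (rule elementary_Sp)
    have "B * A \<in> stab g (Suc k)"
    proof -
      have "B * A \<in> stab g k"
        using subgroup.m_closed[OF stab_subgroup, of k g B A] elementary_stab[of k g] B(1) A k by auto
      then show ?thesis
        using B(2,3) by (auto simp: stab_def less_Suc_eq Sp_mult_mult_vec[OF BS AS])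
    qed
    then have "B * A \<in> elementary g k"
      using step.IH elementary_mono[of k "Suc k" g] by auto
    then have "inv\<^bsub>Sp TYPE(int) g\<^esub> B * (B * A) \<in> elementary g k"
      by (rule elementary_mult[OF elementary_inv[OF B(1)]])
    then show ?thesis
      by (simp add: Sp_inv_mult_cancel[OF BS AS])
  qed
  then show ?case using elementary_stab[of k g] k by auto
qed

lemma Sp_eq_elementary: "carrier (Sp TYPE(int) g) = elementary g 0"
  using stab_eq_elementary[of 0 g] stab_0[of g, where 'a = int] by simp

section \<open>Images of transvections in a quotient\<close>

text \<open>For \<open>k = 0\<close> every vector is supported, so any two hyperbolic pairs are
  connected through the pair \<open>ea g 0\<close>, \<open>eb g 0\<close>.\<close>

lemma Sp_pair_transitive:
  assumes g: "0 < g" and "z \<in> vecs g" "w \<in> vecs g" "z' \<in> vecs g" "w' \<in> vecs g"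
    and "symp g z w = 1" "symp g z' w' = 1"
  shows "\<exists>A\<in>carrier (Sp TYPE(int) g). A *\<^sub>v z = z' \<and> A *\<^sub>v w = w'"
proof -
  have sup: "vecs g = supported g 0" by (auto simp: supported_def)
  obtain B where B: "B \<in> elementary g 0" "B *\<^sub>v z = ea g 0" "B *\<^sub>v w = eb g 0"
    using elementary_to_basis_pair[OF g] assms sup by metis
  obtain C where C: "C \<in> elementary g 0" "C *\<^sub>v ea g 0 = z'" "C *\<^sub>v eb g 0 = w'"
    using elementary_from_basis_pair[OF g] assms sup by metis
  have "(C * B) *\<^sub>v z = z'" "(C * B) *\<^sub>v w = w'"
    using Sp_mult_mult_vec[OF elementary_Sp[OF C(1)] elementary_Sp[OF B(1)]] assms B C by auto
  then show ?thesis using elementary_Sp[OF elementary_mult[OF C(1) B(1)]] by blast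
qed

lemma coordinate_functional:
  assumes "i < 2 * g"
  shows "\<exists>z\<in>vecs g. \<forall>v\<in>vecs g. symp g z v = (v :: 'a :: comm_ring_1 vec) $ i"
proof (cases "i < g")
  case True
  then show ?thesis by (intro bexI[of _ "- 1 \<cdot>\<^sub>v eb g i"]) (auto simp: symp_smult_left)
next
  case False
  then have "i - g < g" "g + (i - g) = i" using assms by auto
  then show ?thesis by (intro bexI[of _ "ea g (i - g)"]) (auto simp: symp_ea_left)
qed

text \<open>Canonical integer representatives of the vectors modulo 2.\<close>

definition binary :: "nat \<Rightarrow> int vec set" where
  "binary g = {v \<in> vecs g. \<forall>i<2 * g. v $ i = 0 \<or> v $ i = 1}"

text \<open>Besides coset projections, the identity is an instance; it serves to lift matrices from
  \<open>bit\<close> to the integers in \<open>red_mat_surj\<close>.\<close>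

locale Sp_quotient = group_hom "Sp TYPE(int) g" H h
  for g :: nat and H (structure) and h +
  assumes surj: "h ` carrier (Sp TYPE(int) g) = carrier H"
begin

definition tr :: "int vec \<Rightarrow> 'a" where
  "tr u = h (transvection g u)"

lemma tr_closed [simp]: "u \<in> vecs g \<Longrightarrow> tr u \<in> carrier H"
  by (simp add: tr_def transvection_in_Sp)

lemma h_mult:
  "A \<in> carrier (Sp TYPE(int) g) \<Longrightarrow> B \<in> carrier (Sp TYPE(int) g) \<Longrightarrow> h (A * B) = h A \<otimes> h B"
  using hom_mult[of A B] by simp

lemma tr_conj:
  assumes "A \<in> carrier (Sp TYPE(int) g)" "u \<in> vecs g"
  shows "h A \<otimes> tr u = tr (A *\<^sub>v u) \<otimes> h A"
  unfolding tr_def using Sp_conj_transvection[OF assms] assms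
  by (simp add: h_mult[symmetric] transvection_in_Sp)

text \<open>By \<open>tr_conj\<close>, the left side is the conjugate of \<open>tr u\<close> by
  \<open>h A\<close>, so only the value \<open>h A\<close> matters.\<close>

lemma tr_cong:
  assumes "A \<in> carrier (Sp TYPE(int) g)" "B \<in> carrier (Sp TYPE(int) g)" "h A = h B" "u \<in> vecs g"
  shows "tr (A *\<^sub>v u) = tr (B *\<^sub>v u)"
proof -
  have "tr (A *\<^sub>v u) \<otimes> h A = tr (B *\<^sub>v u) \<otimes> h A"
    using tr_conj[of A u] tr_conj[of B u] assms by simp
  then show ?thesis using assms by simp
qed

lemma tr_eq_transfer:
  assumes "A \<in> carrier (Sp TYPE(int) g)" "u \<in> vecs g" "v \<in> vecs g" "tr u = tr v"
  shows "tr (A *\<^sub>v u) = tr (A *\<^sub>v v)"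
proof -
  have "tr (A *\<^sub>v u) \<otimes> h A = tr (A *\<^sub>v v) \<otimes> h A"
    using tr_conj[of A u] tr_conj[of A v] assms by simp
  then show ?thesis using assms by simp
qed

lemma tr_minus: "u \<in> vecs g \<Longrightarrow> tr (- 1 \<cdot>\<^sub>v u) = tr u"
  unfolding tr_def by (simp add: transvection_smult_unit)

text \<open>If \<open>symp g z w = \<plusminus>1\<close>, then the transvections along \<open>z\<close> and \<open>w\<close> satisfy the braid relation.\<close>

lemma braid_commute_imp_eq:
  assumes zw: "z \<in> vecs g" "w \<in> vecs g" and c: "\<bar>symp g z w\<bar> = 1"
    and comm: "tr z \<otimes> tr w = tr w \<otimes> tr z"
  shows "tr z = tr w"
proof -
  \<comment> \<open>This product sends \<open>z\<close> to \<open>w\<close> up to sign, so its image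
    conjugates \<open>tr z\<close> into \<open>tr w\<close>. On the other hand the image commutes
    with \<open>tr z\<close>, since both of its factors do.\<close>
  let ?A = "transvection g z * transvection g w"
  have A: "?A \<in> carrier (Sp TYPE(int) g)" "h ?A = tr z \<otimes> tr w"
    using zw by (simp_all add: Sp_mult_closed transvection_in_Sp h_mult tr_def)
  have cc: "symp g w z * symp g w z = 1"
    using c symp_swap[of g w z] by (metis abs_mult_self_eq abs_minus_cancel mult_1)
  have "?A *\<^sub>v z = transvection g z *\<^sub>v (z + symp g w z \<cdot>\<^sub>v w)"
    using zw Sp_mult_mult_vec[OF transvection_in_Sp[OF zw(1)] transvection_in_Sp[OF zw(2)] zw(1)]
    by (simp add: transvection_mult_vec)
  also have "\<dots> = symp g w z \<cdot>\<^sub>v w"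
  proof -
    have "symp g z (z + symp g w z \<cdot>\<^sub>v w) = - 1"
      using zw cc symp_swap[of g z w] by (simp add: symp_add_right symp_smult_right)
    then show ?thesis using zw by (subst transvection_mult_vec) (auto intro!: eq_vecI)
  qed
  finally have "h ?A \<otimes> tr z = tr w \<otimes> h ?A"
    using tr_conj[OF A(1) zw(1)] transvection_smult_unit[OF cc zw(2)] by (simp add: tr_def)
  moreover have "h ?A \<otimes> tr z = tr z \<otimes> h ?A"
    using comm A(2) zw by (metis H.m_assoc tr_closed)
  ultimately show ?thesis using A zw by (metis H.right_cancel hom_closed tr_closed)
qed

lemma generated_by_basic: "generate H (tr ` basic_vecs g 0) = carrier H"
proof -
  have "h ` generate (Sp TYPE(int) g) (transvection g ` basic_vecs g 0)
      = generate H (h ` transvection g ` basic_vecs g 0)"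
    by (rule generate_img[symmetric]) (auto intro!: transvection_in_Sp basic_vecs_vecs)
  then show ?thesis
    using surj Sp_eq_elementary[of g] by (simp add: elementary_def image_image tr_def)
qed

text \<open>Vectors with pairing 1 form a single orbit of pairs, so one coincidence spreads to all
  of them. Such pairs link all basic vectors, hence one element generates \<open>H\<close>.\<close>

lemma collapse_imp_cyclic:
  assumes zw: "z \<in> vecs g" "w \<in> vecs g" "\<bar>symp g z w\<bar> = 1" and eq: "tr z = tr w"
  shows "cyclic_group H"
proof -
  have g: "0 < g" using zw(3) by (cases g) (auto simp: symp_def)
  obtain z0 where z0: "z0 \<in> vecs g" "symp g z0 w = 1" "tr z0 = tr w"
  proof (cases "symp g z w = 1")
    case False
    then have "symp g (- 1 \<cdot>\<^sub>v z) w = 1" using zw by (simp add: symp_smult_left abs_if split: if_splits)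
    then show ?thesis using that[of "- 1 \<cdot>\<^sub>v z"] zw eq by (simp add: tr_minus)
  qed (use that zw eq in auto)
  have all: "tr z' = tr w'" if "z' \<in> vecs g" "w' \<in> vecs g" "symp g z' w' = 1" for z' w'
    using Sp_pair_transitive[OF g z0(1) zw(2) that(1,2) z0(2) that(3)] tr_eq_transfer z0 zw by metis
  have ab: "tr (ea g i) = tr (eb g i)" if "i < g" for i
    using that by (intro all) auto
  have b0: "tr (eb g i) = tr (eb g 0)" if "i < g" for i
  proof (cases "i = 0")
    case False
    \<comment> \<open>The vector \<open>ea g i - ea g 0\<close> pairs with both
      \<open>eb g 0\<close> and \<open>eb g i\<close> to a unit, and so connects two planes.\<close>
    have "tr (eb g 0) = tr (ea g i - ea g 0)"
      using that g False by (intro all) (auto simp: symp_diff_right)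
    moreover have "tr (ea g i - ea g 0) = tr (eb g i)"
      using that g False by (intro all) (auto simp: symp_diff_left)
    ultimately show ?thesis by simp
  qed simp
  have "tr (ea g i - ea g j) = tr (eb g 0)" if "i < g" "j < g" "i \<noteq> j" for i j
    using all[of "ea g i - ea g j" "eb g i"] that b0[of i] by (auto simp: symp_diff_left)
  then have "tr ` basic_vecs g 0 \<subseteq> {tr (eb g 0)}"
    using ab b0 by (auto simp: basic_vecs_def)
  moreover have "tr (eb g 0) \<in> tr ` basic_vecs g 0"
    using g by (auto simp: basic_vecs_def)
  ultimately have "tr ` basic_vecs g 0 = {tr (eb g 0)}" by blast
  then have "carrier H = generate H {tr (eb g 0)}"
    using generated_by_basic by simp
  also have "\<dots> = {tr (eb g 0) [^] k |k :: int. k \<in> UNIV}"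
    by (rule H.generate_pow) simp
  also have "\<dots> = range (\<lambda>n :: int. tr (eb g 0) [^] n)"
    by blast
  finally have "carrier H = range (\<lambda>n :: int. tr (eb g 0) [^] n)" .
  then show ?thesis
    unfolding H.cyclic_group using tr_closed[of "eb g 0"] by (metis unit_vec_carrier)
qed

end

locale Sp_noncyclic_quotient = Sp_quotient +
  assumes noncyclic: "\<not> cyclic_group H"
begin

text \<open>The transvection along \<open>z\<close> fixes \<open>v\<close>, so \<open>tr z\<close>
  commutes with \<open>tr v\<close>; if this were \<open>tr w\<close>, the braid relation would give
  \<open>tr z = tr w\<close>.\<close>

lemma tr_neq:
  assumes "v \<in> vecs g" "w \<in> vecs g" "z \<in> vecs g" "symp g z v = 0" "\<bar>symp g z w\<bar> = 1"
  shows "tr v \<noteq> tr w"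
proof
  assume eq: "tr v = tr w"
  have "transvection g z *\<^sub>v v = v"
    using assms by (auto simp: transvection_mult_vec intro!: eq_vecI)
  then have "tr z \<otimes> tr v = tr v \<otimes> tr z"
    using tr_conj[OF transvection_in_Sp, of z v] assms by (simp add: tr_def)
  then have "tr z = tr w"
    using braid_commute_imp_eq[of z w] assms eq by simp
  then show False
    using collapse_imp_cyclic[of z w] assms noncyclic by blast
qed

text \<open>Every functional is a pairing; the \<open>z\<close> needed for \<open>tr_neq\<close>
  represents entry \<open>i\<close> minus \<open>c\<close> times entry \<open>j\<close>.\<close>

lemma tr_neq_coordinates:
  assumes "v \<in> vecs g" "w \<in> vecs g" "i < 2 * g" "j < 2 * g"
    and "v $ i = c * v $ j" "\<bar>w $ i - c * w $ j\<bar> = 1"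
  shows "tr v \<noteq> tr w"
proof -
  obtain x :: "int vec" where x: "x \<in> vecs g" "\<And>v. v \<in> vecs g \<Longrightarrow> symp g x v = v $ i"
    using coordinate_functional[OF assms(3), where 'a = int] by blast
  obtain y :: "int vec" where y: "y \<in> vecs g" "\<And>v. v \<in> vecs g \<Longrightarrow> symp g y v = v $ j"
    using coordinate_functional[OF assms(4), where 'a = int] by blast
  show ?thesis
    using assms x y
    by (intro tr_neq[of v w "x - c \<cdot>\<^sub>v y"]) (auto simp: symp_diff_left symp_smult_left)
qed

text \<open>Where two 0-1 vectors differ, a coordinate functional is 0 on one and 1 on the other;
  this is the case \<open>c = 0\<close> above.\<close>

lemma tr_inj_on_binary: "inj_on tr (binary g)"
proof (rule inj_onI)
  fix v w assume v: "v \<in> binary g" and w: "w \<in> binary g" and eq: "tr v = tr w"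
  then have vw: "v \<in> vecs g" "w \<in> vecs g" by (auto simp: binary_def)
  show "v = w"
  proof (rule eq_vecI)
    fix i assume "i < dim_vec w"
    then have i: "i < 2 * g" using vw by simp
    then have "v $ i = 0 \<or> v $ i = 1" "w $ i = 0 \<or> w $ i = 1"
      using v w by (auto simp: binary_def)
    then show "v $ i = w $ i"
      using tr_neq_coordinates[OF vw i i, of 0] tr_neq_coordinates[OF vw(2,1) i i, of 0] eq by auto
  qed (use vw in auto)
qed

end

section \<open>Reduction modulo 2\<close>

abbreviation red_vec :: "int vec \<Rightarrow> bit vec" where
  "red_vec \<equiv> map_vec of_int"

abbreviation red_mat :: "int mat \<Rightarrow> bit mat" where
  "red_mat \<equiv> map_mat of_int"

text \<open>The section of the reduction with values in \<open>binary\<close>: an entry 1 lifts to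
  exactly 1, not just to an odd number.\<close>

definition lift_vec :: "bit vec \<Rightarrow> int vec" where
  "lift_vec v = map_vec (\<lambda>b. of_bool (b = 1)) v"

lemma of_int_bit_eq_iff: "(of_int x :: bit) = of_int y \<longleftrightarrow> x mod 2 = y mod 2"
proof -
  have "(of_int x :: bit) = of_bool (odd x)" for x
    by (cases "even x") (auto elim!: evenE oddE)
  then show ?thesis by (auto simp: mod2_eq_if)
qed

lemma red_lift_vec [simp]: "red_vec (lift_vec v) = v"
  by (auto simp: lift_vec_def intro!: eq_vecI)

lemma lift_vec_vecs [simp]: "v \<in> vecs g \<Longrightarrow> lift_vec v \<in> vecs g"
  by (simp add: lift_vec_def)

lemma lift_vec_nth: "v \<in> vecs g \<Longrightarrow> i < 2 * g \<Longrightarrow> lift_vec v $ i = of_bool (v $ i = 1)"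
  by (simp add: lift_vec_def)

lemma lift_vec_binary: "v \<in> vecs g \<Longrightarrow> lift_vec v \<in> binary g"
  by (auto simp: lift_vec_def binary_def)

lemma lift_vec_supported: "k \<le> g \<Longrightarrow> v \<in> supported g k \<Longrightarrow> lift_vec v \<in> supported g k"
  by (auto simp: lift_vec_def supported_def)

lemma binary_vecs: "v \<in> binary g \<Longrightarrow> v \<in> vecs g"
  by (simp add: binary_def)

lemma zero_binary: "0\<^sub>v (2 * g) \<in> binary g"
  by (simp add: binary_def)

lemma binary_nth: "v \<in> binary g \<Longrightarrow> i < 2 * g \<Longrightarrow> v $ i = 0 \<or> v $ i = 1"
  by (simp add: binary_def)

lemma binary_red_inj:
  assumes "v \<in> binary g" "w \<in> binary g" "red_vec v = red_vec w"
  shows "v = w"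
proof (rule eq_vecI)
  fix i assume "i < dim_vec w"
  then have i: "i < 2 * g" using assms by (auto simp: binary_def)
  then have "(of_int (v $ i) :: bit) = of_int (w $ i)"
    using arg_cong[OF assms(3), of "\<lambda>v. v $ i"] assms(1,2) by (auto simp: binary_def)
  moreover have "v $ i = 0 \<or> v $ i = 1" "w $ i = 0 \<or> w $ i = 1"
    using assms(1,2) i by (simp_all add: binary_nth)
  ultimately show "v $ i = w $ i" by auto
qed (use assms in \<open>auto simp: binary_def\<close>)

lemma symp_red: "v \<in> vecs g \<Longrightarrow> w \<in> vecs g \<Longrightarrow> symp g (red_vec v) (red_vec w) = of_int (symp g v w)"
  by (simp add: symp_def)

lemma red_unit_vec [simp]: "i < n \<Longrightarrow> red_vec (unit_vec n i) = unit_vec n i"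
  by (auto simp: unit_vec_def intro!: eq_vecI)

lemma red_zero_vec: "red_vec (0\<^sub>v n) = 0\<^sub>v n"
  by (rule of_int_hom.vec_hom_zero)

lemma red_mult_vec:
  "A \<in> carrier_mat n m \<Longrightarrow> v \<in> carrier_vec m \<Longrightarrow> red_vec (A *\<^sub>v v) = red_mat A *\<^sub>v red_vec v"
  by (rule of_int_hom.mult_mat_vec_hom)

text \<open>All vectors over \<open>bit\<close> have integer lifts, from which invariance of the
  form is inherited.\<close>

lemma red_mat_in_Sp:
  assumes A: "A \<in> carrier (Sp TYPE(int) g)"
  shows "red_mat A \<in> carrier (Sp TYPE(bit) g)"
  unfolding carrier_Sp_iff
proof (intro conjI ballI)
  have Am: "A \<in> carrier_mat (2 * g) (2 * g)" using A by (rule Sp_carrier_mat)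
  then show "red_mat A \<in> carrier_mat (2 * g) (2 * g)" by simp
  fix v w :: "bit vec" assume vw: "v \<in> vecs g" "w \<in> vecs g"
  have eq: "red_mat A *\<^sub>v v = red_vec (A *\<^sub>v lift_vec v)" if "v \<in> vecs g" for v
    using red_mult_vec[OF Am, of "lift_vec v"] that by simp
  have "symp g (red_mat A *\<^sub>v v) (red_mat A *\<^sub>v w) = of_int (symp g (A *\<^sub>v lift_vec v) (A *\<^sub>v lift_vec w))"
    using A vw by (simp add: eq symp_red)
  also have "\<dots> = of_int (symp g (lift_vec v) (lift_vec w))"
    using A vw by (simp add: Sp_symp)
  also have "\<dots> = symp g v w"
    using symp_red[of "lift_vec v" g "lift_vec w"] vw by simp
  finally show "symp g (red_mat A *\<^sub>v v) (red_mat A *\<^sub>v w) = symp g v w" .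
qed

lemma red_mat_mult:
  assumes "A \<in> carrier (Sp TYPE(int) g)" "B \<in> carrier (Sp TYPE(int) g)"
  shows "red_mat (A * B) = red_mat A * red_mat B"
  using of_int_hom.mat_hom_mult Sp_carrier_mat assms by blast

lemma red_mat_hom: "group_hom (Sp TYPE(int) g) (Sp TYPE(bit) g) red_mat"
  by (intro group_hom.intro group_hom_axioms.intro group_Sp)
    (auto simp: hom_def red_mat_in_Sp red_mat_mult)

lemma red_mat_stab:
  assumes "A \<in> stab g k" "k \<le> g"
  shows "red_mat A \<in> stab g k"
proof -
  have A: "A \<in> carrier_mat (2 * g) (2 * g)" by (rule Sp_carrier_mat[OF stab_Sp[OF assms(1)]])
  have "red_mat A *\<^sub>v ea g i = ea g i" "red_mat A *\<^sub>v eb g i = eb g i" if "i < k" for i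
    using red_mult_vec[OF A, of "ea g i"] red_mult_vec[OF A, of "eb g i"] that assms
    by (simp_all add: stab_def)
  then show ?thesis using red_mat_in_Sp[OF stab_Sp[OF assms(1)]] by (simp add: stab_def)
qed

text \<open>A nonzero 0-1 vector has an entry 1, and this entry is its pairing with a basis vector
  up to sign. Being supported puts that basis vector beyond the first \<open>k\<close>
  planes.\<close>

lemma binary_has_dual:
  assumes v: "v \<in> binary g" "v \<in> supported g k" "v \<noteq> 0\<^sub>v (2 * g)" and k: "k \<le> g"
  shows "\<exists>u\<in>supported g k. symp g v u = 1"
proof -
  have vv: "v \<in> vecs g" using v(2) by (rule supported_vecs)
  obtain i where i: "i < g" "v $ i \<noteq> 0 \<or> v $ (g + i) \<noteq> 0"
    using vec_eq_halvesI[OF vv zero_carrier_vec] v(3) by auto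
  then have ki: "k \<le> i" using v(2) not_le by (auto simp: supported_def)
  show ?thesis
  proof (cases "v $ i = 0")
    case True
    then have "v $ (g + i) = 1" using i binary_nth[OF v(1), of "g + i"] by simp
    then show ?thesis using i ki by (intro bexI[of _ "- 1 \<cdot>\<^sub>v ea g i"]) (auto simp: symp_smult_right supported_def)
  next
    case False
    then have "v $ i = 1" using i binary_nth[OF v(1), of i] by simp
    then show ?thesis using i ki by (intro bexI[of _ "eb g i"]) auto
  qed
qed

section \<open>Representatives of Sp(2g, Z/2) on which the quotient map is injective\<close>

context Sp_noncyclic_quotient
begin

lemma exists_lift_of_ea:
  assumes v: "v \<in> binary g" "v \<in> supported g k" "v \<noteq> 0\<^sub>v (2 * g)" and k: "k < g"
  shows "\<exists>A\<in>stab g k. A *\<^sub>v ea g k = v"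
  using binary_has_dual[OF v] elementary_from_basis_pair[OF k v(2)] elementary_stab[of k g] k by (metis less_imp_le subsetD)

text \<open>Orbit-stabilizer decomposition along the symplectic basis, by downward induction on
  \<open>k\<close>. The factors can be recovered from values of \<open>h\<close> because
  \<open>tr\<close> separates 0-1 vectors. The last clause is kept for
  \<open>tr_eq_tr_binary\<close>.\<close>

lemma exists_transversal:
  assumes "k \<le> g"
  shows "\<exists>R\<subseteq>stab g k. stab g k \<subseteq> red_mat ` R \<and> inj_on h R \<and>
    (k < g \<longrightarrow> (\<forall>A\<in>R. A *\<^sub>v ea g k \<in> binary g))"
  using assms
proof (induction k rule: inc_induct)
  case base
  have "red_mat (1\<^sub>m (2 * g)) = 1\<^sub>m (2 * g)" by (rule of_int_hom.mat_hom_one)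
  then show ?case
    by (intro exI[of _ "{1\<^sub>m (2 * g)}"]) (simp add: stab_full)
next
  case (step k)
  have k: "k < g" "k \<le> g" using step by auto
  interpret S: group "Sp TYPE(int) g" by (rule group_Sp)
  interpret red: group_hom "Sp TYPE(int) g" "Sp TYPE(bit) g" red_mat by (rule red_mat_hom)
  obtain R where R: "R \<subseteq> stab g (Suc k)" "stab g (Suc k) \<subseteq> red_mat ` R" "inj_on h R"
    using step.IH by auto
  \<comment> \<open>\<open>V\<close> collects the possible 0-1 images of \<open>ea g k\<close>, and
    \<open>U\<close> those of \<open>eb g k\<close> once \<open>ea g k\<close> is fixed;
    \<open>p\<close> and \<open>q\<close> choose matrices realizing them.\<close>
  define V where "V = {v \<in> binary g. \<exists>A\<in>stab g k. A *\<^sub>v ea g k = v}"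
  define U where "U = {u \<in> binary g. \<exists>B\<in>stab g k. B *\<^sub>v ea g k = ea g k \<and> B *\<^sub>v eb g k = u}"
  have "\<forall>v\<in>V. \<exists>A. A \<in> stab g k \<and> A *\<^sub>v ea g k = v" by (auto simp: V_def)
  then obtain p where p: "\<And>v. v \<in> V \<Longrightarrow> p v \<in> stab g k" "\<And>v. v \<in> V \<Longrightarrow> p v *\<^sub>v ea g k = v"
    by (metis (no_types))
  have "\<forall>u\<in>U. \<exists>B. B \<in> stab g k \<and> B *\<^sub>v ea g k = ea g k \<and> B *\<^sub>v eb g k = u" by (auto simp: U_def)
  then obtain q where q: "\<And>u. u \<in> U \<Longrightarrow> q u \<in> stab g k" "\<And>u. u \<in> U \<Longrightarrow> q u *\<^sub>v ea g k = ea g k"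
      "\<And>u. u \<in> U \<Longrightarrow> q u *\<^sub>v eb g k = u"
    by (metis (no_types))
  have pS: "v \<in> V \<Longrightarrow> p v \<in> carrier (Sp TYPE(int) g)" for v using p(1) by (rule stab_Sp)
  have qS: "u \<in> U \<Longrightarrow> q u \<in> carrier (Sp TYPE(int) g)" for u using q(1) by (rule stab_Sp)
  have RS: "r \<in> R \<Longrightarrow> r \<in> carrier (Sp TYPE(int) g)" for r using R(1) stab_Sp by blast
  have Rk: "r \<in> R \<Longrightarrow> r *\<^sub>v ea g k = ea g k" "r \<in> R \<Longrightarrow> r *\<^sub>v eb g k = eb g k" for r
    using R(1) by (auto simp: stab_def)
  have Rs: "r \<in> R \<Longrightarrow> r \<in> stab g k" for r
    using R(1) by (auto simp: stab_def)
  have VU: "v \<in> V \<Longrightarrow> v \<in> binary g" "u \<in> U \<Longrightarrow> u \<in> binary g" for u v by (auto simp: V_def U_def)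
  define R' where "R' = {p v * (q u * r) |v u r. v \<in> V \<and> u \<in> U \<and> r \<in> R}"
  have act: "(q u * r) *\<^sub>v eb g k = u" "(p v * (q u * r)) *\<^sub>v ea g k = v"
    if "v \<in> V" "u \<in> U" "r \<in> R" for v u r
    using that pS qS RS Rk p q
    by (simp_all add: Sp_mult_mult_vec[where g = g and ty = "TYPE(int)"] Sp_mult_closed)
  have "R' \<subseteq> stab g k"
    using subgroup.m_closed[OF stab_subgroup[OF k(2), where 'a = int]] p(1) q(1) Rs
    by (fastforce simp: R'_def)
  moreover have "stab g k \<subseteq> red_mat ` R'"
  proof
    fix A :: "bit mat" assume A: "A \<in> stab g k"
    have AS: "A \<in> carrier (Sp TYPE(bit) g)" using A by (rule stab_Sp)
    define v where "v = lift_vec (A *\<^sub>v ea g k)"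
    have Aa: "A *\<^sub>v ea g k \<in> supported g k" "A *\<^sub>v eb g k \<in> supported g k"
      using stab_image_supported[OF A _ k(2)] k by auto
    have Aab: "symp g (A *\<^sub>v ea g k) (A *\<^sub>v eb g k) = 1" using AS k by (simp add: Sp_symp)
    have "v \<noteq> 0\<^sub>v (2 * g)"
    proof
      assume "v = 0\<^sub>v (2 * g)"
      then have "A *\<^sub>v ea g k = 0\<^sub>v (2 * g)"
        using red_lift_vec[of "A *\<^sub>v ea g k"] by (simp add: v_def of_int_hom.vec_hom_zero)
      then show False using Aab by (simp add: symp_def)
    qed
    then have v: "v \<in> V"
      using exists_lift_of_ea[of v k] lift_vec_binary[OF supported_vecs[OF Aa(1)]]
        lift_vec_supported[OF k(2) Aa(1)] k by (auto simp: V_def v_def)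
    \<comment> \<open>Dividing by the reduction of \<open>p v\<close> leaves a matrix fixing
      \<open>ea g k\<close>.\<close>
    define A1 where "A1 = inv\<^bsub>Sp TYPE(bit) g\<^esub> red_mat (p v) * A"
    have pv: "red_mat (p v) \<in> stab g k" using red_mat_stab p(1) v k by blast
    have A1: "A1 \<in> stab g k"
      unfolding A1_def using subgroup.m_closed[OF stab_subgroup[OF k(2)] subgroup.m_inv_closed[OF stab_subgroup[OF k(2)] pv] A] by simp
    have pA1: "red_mat (p v) * A1 = A"
      unfolding A1_def using red.H.m_assoc[of "red_mat (p v)" "inv\<^bsub>Sp TYPE(bit) g\<^esub> red_mat (p v)" A] red.H.r_inv[of "red_mat (p v)"]
        red.H.inv_closed[of "red_mat (p v)"] red.H.l_one[OF AS] AS stab_Sp[OF pv] by simp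
    have A1S: "A1 \<in> carrier (Sp TYPE(bit) g)" using A1 by (rule stab_Sp)
    have A1a: "A1 *\<^sub>v ea g k = ea g k"
    proof -
      have "red_mat (p v) *\<^sub>v ea g k = red_vec (p v *\<^sub>v ea g k)"
        using red_mult_vec[OF Sp_carrier_mat[OF pS[OF v]], of "ea g k"] k by simp
      then have "red_mat (p v) *\<^sub>v ea g k = A *\<^sub>v ea g k"
        using p(2)[OF v] by (simp add: v_def)
      then show ?thesis
        using Sp_inv_mult_vec(1)[OF stab_Sp[OF pv], of "ea g k"]
          Sp_mult_mult_vec[OF red.H.inv_closed[OF stab_Sp[OF pv]] AS, of "ea g k"] by (simp add: A1_def)
    qed
    define u where "u = lift_vec (A1 *\<^sub>v eb g k)"
    have A1b: "A1 *\<^sub>v eb g k \<in> supported g k"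
      using stab_image_supported[OF A1 _ k(2)] k by auto
    have us: "u \<in> supported g k" "u \<in> binary g"
      unfolding u_def using A1b k by (auto intro: lift_vec_supported lift_vec_binary supported_vecs)
    \<comment> \<open>The image of \<open>eb g k\<close> is lifted only now: as
      \<open>ea g k\<close> is fixed, the pairing is the single entry at \<open>g + k\<close>, which
      lifts to exactly 1. The lifts of an arbitrary pair would only have odd pairing.\<close>
    have "symp g (A1 *\<^sub>v ea g k) (A1 *\<^sub>v eb g k) = 1" using A1S k by (simp add: Sp_symp)
    then have "(A1 *\<^sub>v eb g k) $ (g + k) = 1" using A1a k by simp
    then have "u $ (g + k) = 1" using lift_vec_nth[OF supported_vecs[OF A1b], of "g + k"] k by (simp add: u_def)
    then have "symp g (ea g k) u = 1" using k by simp
    then obtain B where "B \<in> elementary g k" "B *\<^sub>v ea g k = ea g k" "B *\<^sub>v eb g k = u"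
      using elementary_from_basis_pair[OF k(1) _ us(1), of "ea g k"] k by auto
    then have u: "u \<in> U" using us elementary_stab[OF k(2)] by (auto simp: U_def)
    define A2 where "A2 = inv\<^bsub>Sp TYPE(bit) g\<^esub> red_mat (q u) * A1"
    have qu: "red_mat (q u) \<in> stab g k" using red_mat_stab q(1) u k by blast
    have A2: "A2 \<in> stab g k"
      unfolding A2_def using subgroup.m_closed[OF stab_subgroup[OF k(2)] subgroup.m_inv_closed[OF stab_subgroup[OF k(2)] qu] A1] by simp
    have qA2: "red_mat (q u) * A2 = A1"
      unfolding A2_def using red.H.m_assoc[of "red_mat (q u)" "inv\<^bsub>Sp TYPE(bit) g\<^esub> red_mat (q u)" A1] red.H.r_inv[of "red_mat (q u)"]
        red.H.inv_closed[of "red_mat (q u)"] red.H.l_one[OF A1S] A1S stab_Sp[OF qu] by simp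
    have "A2 *\<^sub>v w = w" if "red_mat (q u) *\<^sub>v w = A1 *\<^sub>v w" "w \<in> vecs g" for w
      using Sp_inv_mult_vec(1)[OF stab_Sp[OF qu] that(2)] that
        Sp_mult_mult_vec[OF red.H.inv_closed[OF stab_Sp[OF qu]] A1S that(2)] by (simp add: A2_def)
    moreover have "red_mat (q u) *\<^sub>v ea g k = A1 *\<^sub>v ea g k"
      using red_mult_vec[OF Sp_carrier_mat[OF qS[OF u]], of "ea g k"] k q(2)[OF u] A1a by simp
    moreover have "red_mat (q u) *\<^sub>v eb g k = A1 *\<^sub>v eb g k"
      using red_mult_vec[OF Sp_carrier_mat[OF qS[OF u]], of "eb g k"] k q(3)[OF u] by (simp add: u_def)
    ultimately have "A2 \<in> stab g (Suc k)"
      using A2 by (auto simp: stab_def less_Suc_eq)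
    then obtain r where r: "r \<in> R" "red_mat r = A2" using R(2) by auto
    have "red_mat (p v * (q u * r)) = A"
      using r pA1 qA2 pS[OF v] qS[OF u] RS[OF r(1)] by (simp add: red_mat_mult[where g = g] Sp_mult_closed)
    then show "A \<in> red_mat ` R'" using v u r by (force simp: R'_def)
  qed
  moreover have "inj_on h R'"
  proof (rule inj_onI)
    fix x y assume "x \<in> R'" "y \<in> R'" and h: "h x = h y"
    then obtain v u r v' u' r' where x: "x = p v * (q u * r)" "v \<in> V" "u \<in> U" "r \<in> R"
      and y: "y = p v' * (q u' * r')" "v' \<in> V" "u' \<in> U" "r' \<in> R" by (auto simp: R'_def)
    note S = pS[OF x(2)] qS[OF x(3)] RS[OF x(4)] pS[OF y(2)] qS[OF y(3)] RS[OF y(4)]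
    \<comment> \<open>The value of \<open>h\<close> determines \<open>tr\<close> of the image of
      \<open>ea g k\<close>, hence \<open>v\<close>. Cancelling \<open>h (p v)\<close> gives
      \<open>u\<close> from the image of \<open>eb g k\<close> in the same way, and finally
      \<open>h r\<close>.\<close>
    have "tr (x *\<^sub>v ea g k) = tr (y *\<^sub>v ea g k)"
      using S h by (intro tr_cong) (auto simp: x(1) y(1) Sp_mult_closed)
    then have vv: "v = v'"
      using act(2)[OF x(2-4)] act(2)[OF y(2-4)] x y inj_onD[OF tr_inj_on_binary _ VU(1) VU(1)] by simp
    then have h1: "h (q u * r) = h (q u' * r')"
      using h S by (simp add: x(1) y(1) h_mult[of "p v'"] Sp_mult_closed)
    then have "tr ((q u * r) *\<^sub>v eb g k) = tr ((q u' * r') *\<^sub>v eb g k)"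
      using S by (intro tr_cong) (auto simp: Sp_mult_closed)
    then have uu: "u = u'"
      using act(1)[OF x(2-4)] act(1)[OF y(2-4)] x y inj_onD[OF tr_inj_on_binary _ VU(2) VU(2)] by simp
    then have "h r = h r'"
      using h1 S by (simp add: h_mult)
    then have "r = r'" using inj_onD[OF R(3)] x(4) y(4) by blast
    then show "x = y" using x(1) y(1) vv uu by simp
  qed
  moreover have "\<forall>A\<in>R'. A *\<^sub>v ea g k \<in> binary g"
    using act(2) VU(1) by (auto simp: R'_def)
  ultimately show ?case by blast
qed

end

section \<open>Finiteness, non-cyclicity and surjectivity of the reduction\<close>

lemma finite_carrier_Sp_bit: "finite (carrier (Sp TYPE(bit) g))"
proof -
  let ?n = "2 * g"
  \<comment> \<open>A matrix over \<open>bit\<close> is determined by the positions of its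
    ones.\<close>
  let ?f = "\<lambda>A :: bit mat. {(i, j). i < ?n \<and> j < ?n \<and> A $$ (i, j) = 1}"
  have "?f ` carrier_mat ?n ?n \<subseteq> Pow ({..<?n} \<times> {..<?n})" by auto
  then have "finite (?f ` carrier_mat ?n ?n)" by (rule finite_subset) simp
  moreover have "inj_on ?f (carrier_mat ?n ?n)"
  proof (intro inj_onI eq_matI)
    fix A B :: "bit mat" and i j
    assume AB: "A \<in> carrier_mat ?n ?n" "B \<in> carrier_mat ?n ?n" and eq: "?f A = ?f B"
      and "i < dim_row B" "j < dim_col B"
    then have "A $$ (i, j) = 1 \<longleftrightarrow> B $$ (i, j) = 1" by auto
    then show "A $$ (i, j) = B $$ (i, j)" by (metis bit_not_one_iff)
  qed auto
  ultimately have "finite (carrier_mat ?n ?n :: bit mat set)" by (rule finite_imageD)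
  then show ?thesis by (rule rev_finite_subset) (auto dest: Sp_carrier_mat)
qed

text \<open>Applied to \<open>ea g 0\<close>, the two products differ in coordinate 0: one gives 0,
  the other 1.\<close>

lemma Sp_noncommutative:
  assumes "0 < g"
  shows "transvection g (ea g 0) * transvection g (eb g 0) \<noteq>
    transvection g (eb g 0) * (transvection g (ea g 0) :: 'a :: comm_ring_1 mat)"
proof
  let ?A = "transvection g (ea g 0) :: 'a mat" and ?B = "transvection g (eb g 0) :: 'a mat"
  let ?v = "ea g 0 - eb g 0 :: 'a vec"
  assume eq: "?A * ?B = ?B * ?A"
  have S: "?A \<in> carrier (Sp TYPE('a) g)" "?B \<in> carrier (Sp TYPE('a) g)"
    by (auto intro: transvection_in_Sp)
  have B: "?B *\<^sub>v ea g 0 = ?v"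
    using assms by (auto simp: transvection_mult_vec intro!: eq_vecI)
  have A: "?A *\<^sub>v ea g 0 = ea g 0"
    using assms by (auto simp: transvection_mult_vec intro!: eq_vecI)
  have "?A *\<^sub>v ?v = ?v"
    using arg_cong[OF eq, of "\<lambda>X. X *\<^sub>v ea g 0"] by (simp only: Sp_mult_mult_vec[OF S unit_vec_carrier] Sp_mult_mult_vec[OF S(2,1) unit_vec_carrier] A B)
  moreover have "(?A *\<^sub>v ?v) $ 0 = 0"
    using assms by (subst transvection_mult_vec) (auto simp: symp_diff_right)
  moreover have "?v $ 0 = 1" using assms by simp
  ultimately show False by simp
qed

lemma Sp_not_cyclic:
  assumes "0 < g"
  shows "\<not> cyclic_group (Sp TYPE('a :: comm_ring_1) g)"
proof
  assume "cyclic_group (Sp TYPE('a) g)"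
  then interpret comm_group "Sp TYPE('a) g"
    by (rule group.cyclic_imp_abelian_group[OF group_Sp])
  show False
    using Sp_noncommutative[OF assms, where 'a = 'a] m_comm[of "transvection g (ea g 0)" "transvection g (eb g 0)"]
    by (auto simp: transvection_in_Sp)
qed

text \<open>The integral group is not cyclic, so \<open>exists_transversal\<close> applies to the
  identity map and supplies the lifts.\<close>

lemma red_mat_surj:
  assumes "0 < g"
  shows "red_mat ` carrier (Sp TYPE(int) g) = carrier (Sp TYPE(bit) g)"
proof -
  interpret Sp_noncyclic_quotient g "Sp TYPE(int) g" "\<lambda>A. A"
    by (intro Sp_noncyclic_quotient.intro Sp_quotient.intro group_hom.intro group_hom_axioms.intro
        Sp_quotient_axioms.intro Sp_noncyclic_quotient_axioms.intro group_Sp Sp_not_cyclic assms)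
      (auto simp: hom_def Sp_mult_closed)
  obtain R where "R \<subseteq> stab g 0" "stab g 0 \<subseteq> red_mat ` R"
    using exists_transversal[of 0] by auto
  then show ?thesis
    using red_mat_in_Sp by (fastforce simp: stab_0)
qed

section \<open>Dependence of \<open>tr\<close> on the residue class modulo 2\<close>

context Sp_noncyclic_quotient
begin

text \<open>Entries 0 and those of absolute value 1 are detected by coordinate functionals. An entry
  2 becomes detectable through an entry 1 elsewhere, since entry \<open>i\<close> minus twice entry
  \<open>j\<close> vanishes on \<open>v\<close>.\<close>

lemma red_eq_of_tr_eq:
  assumes v: "v \<in> vecs g" and w: "w \<in> binary g" and eq: "tr v = tr w"
    and entries: "\<And>i. i < 2 * g \<Longrightarrow>
      v $ i \<in> {0, 1, -1} \<or> v $ i = 2 \<and> (\<exists>j<2 * g. v $ j = 1)"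
  shows "red_vec v = red_vec w"
proof -
  have wv: "w \<in> vecs g" using w by (simp add: binary_def)
  have zero: "w $ i = 0" if "i < 2 * g" "v $ i = 0" for i
    using tr_neq_coordinates[OF v wv that(1) that(1), of 0] that eq binary_nth[OF w that(1)] by auto
  have unit: "w $ i = 1" if "i < 2 * g" "\<bar>v $ i\<bar> = 1" for i
    using tr_neq_coordinates[OF wv v that(1) that(1), of 0] that eq binary_nth[OF w that(1)] by auto
  \<comment> \<open>Here \<open>w $ j = 1\<close>, so \<open>w $ i = 1\<close> would give the
    functional the value \<open>1 - 2 = - 1\<close> on \<open>w\<close>.\<close>
  have two: "w $ i = 0" if "i < 2 * g" "v $ i = 2" "j < 2 * g" "v $ j = 1" for i j
    using tr_neq_coordinates[OF v wv that(1) that(3), of 2] that eq binary_nth[OF w that(1)] unit[of j] by auto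
  have "v $ i mod 2 = w $ i mod 2" if "i < 2 * g" for i
    using entries[OF that] zero[OF that] unit[OF that] two[OF that] by auto
  then show ?thesis
    using v wv by (intro eq_vecI) (auto simp: of_int_bit_eq_iff)
qed

text \<open>An entry can become 2 only if \<open>symp g u v\<close> is nonzero. For \<open>u\<close>
  built from the \<open>ea\<close> vectors this forces an entry 1 of \<open>v\<close> in the second
  half, which the transvection leaves unchanged; for \<open>eb g j\<close> no entry 2
  arises.\<close>

lemma basic_transvection_entries:
  assumes u: "u \<in> basic_vecs g 0" and v: "v \<in> binary g" and i: "i < 2 * g"
  defines "w \<equiv> transvection g u *\<^sub>v v"
  shows "w $ i \<in> {0, 1, -1} \<or> w $ i = 2 \<and> (\<exists>j<2 * g. w $ j = 1)"
proof -
  have vv: "v \<in> vecs g" using v by (simp add: binary_def)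
  have uv: "u \<in> vecs g" using u by (rule basic_vecs_vecs)
  have w: "w $ m = v $ m + symp g u v * u $ m" if "m < 2 * g" for m
    using that uv vv by (simp add: w_def transvection_mult_vec del: index_mult_mat_vec)
  note bin = binary_nth[OF v]
  consider (a) j where "j < g" "u = ea g j" | (b) j where "j < g" "u = eb g j"
    | (ab) j k where "j < g" "k < g" "j \<noteq> k" "u = ea g j - ea g k"
    using u by (auto simp: basic_vecs_def)
  then show ?thesis
  proof cases
    case a
    have "w $ (g + j) = v $ (g + j)" using a by (simp add: w)
    moreover have "w $ i = v $ i + (if i = j then v $ (g + j) else 0)"
      using a i by (simp add: w)
    ultimately show ?thesis
      using bin[OF i] bin[of "g + j"] a by (auto split: if_splits intro!: exI[of _ "g + j"])
  next
    case b
    have "w $ i = v $ i - (if i = g + j then v $ j else 0)"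
      using b i by (simp add: w)
    then show ?thesis using bin[OF i] bin[of j] b by (auto split: if_splits)
  next
    case ab
    have s: "symp g u v = v $ (g + j) - v $ (g + k)" using ab by (simp add: symp_diff_left)
    have wb: "w $ (g + m) = v $ (g + m)" if "m < g" for m using ab that by (simp add: w)
    have "w $ i = v $ i + (v $ (g + j) - v $ (g + k)) * (if i = j then 1 else if i = k then -1 else 0)"
      unfolding w[OF i] s using ab i by simp
    then show ?thesis
      using bin[OF i] bin[of "g + j"] bin[of "g + k"] wb[of j] wb[of k] ab
      by (elim disjE; simp split: if_splits; force)
  qed
qed

text \<open>Here \<open>w\<close> is the 0-1 representative of the image of \<open>v\<close>.
  Nonzero \<open>v\<close> are taken because these are images of \<open>ea g 0\<close> under
  integral symplectic matrices.\<close>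

definition preserves_reduction :: "int mat \<Rightarrow> bool" where
  "preserves_reduction A \<longleftrightarrow> (\<forall>v\<in>binary g. \<forall>w\<in>binary g.
     v \<noteq> 0\<^sub>v (2 * g) \<longrightarrow> red_vec (A *\<^sub>v v) = red_vec w \<longrightarrow> tr (A *\<^sub>v v) = tr w)"

text \<open>The reduction of \<open>A\<close> is inverted by that of its inverse, so it cannot kill
  the nonzero class of \<open>v\<close>.\<close>

lemma red_image_nonzero:
  assumes A: "A \<in> carrier (Sp TYPE(int) g)" and v: "v \<in> binary g" "v \<noteq> 0\<^sub>v (2 * g)"
    and w: "red_vec (A *\<^sub>v v) = red_vec w"
  shows "w \<noteq> 0\<^sub>v (2 * g)"
proof
  assume "w = 0\<^sub>v (2 * g)"
  then have "red_vec (A *\<^sub>v v) = 0\<^sub>v (2 * g)" using w by (simp add: red_zero_vec)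
  moreover have iA: "inv\<^bsub>Sp TYPE(int) g\<^esub> A \<in> carrier_mat (2 * g) (2 * g)"
    using group.inv_closed[OF group_Sp A] by (rule Sp_carrier_mat)
  have "red_vec v = red_mat (inv\<^bsub>Sp TYPE(int) g\<^esub> A) *\<^sub>v red_vec (A *\<^sub>v v)"
    using red_mult_vec[OF iA, of "A *\<^sub>v v"] Sp_inv_mult_vec(1)[OF A binary_vecs[OF v(1)]] A binary_vecs[OF v(1)]
    by simp
  ultimately have "red_vec v = red_vec (0\<^sub>v (2 * g))"
    using iA by (auto simp: red_zero_vec intro!: eq_vecI)
  then show False using binary_red_inj[OF v(1) zero_binary] v(2) by blast
qed

lemma preserves_reductionD:
  assumes "preserves_reduction A" "v \<in> binary g" "w \<in> binary g" "v \<noteq> 0\<^sub>v (2 * g)"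
    "red_vec (A *\<^sub>v v) = red_vec w"
  shows "tr (A *\<^sub>v v) = tr w"
  using assms unfolding preserves_reduction_def by blast

lemma preserves_reduction_mult:
  assumes A: "A \<in> carrier (Sp TYPE(int) g)" "preserves_reduction A"
    and B: "B \<in> carrier (Sp TYPE(int) g)" "preserves_reduction B"
  shows "preserves_reduction (A * B)"
  unfolding preserves_reduction_def
proof (intro ballI impI)
  fix v w assume v: "v \<in> binary g" "v \<noteq> 0\<^sub>v (2 * g)" and w: "w \<in> binary g"
    and red: "red_vec (A * B *\<^sub>v v) = red_vec w"
  note vv = binary_vecs[OF v(1)]
  have AB: "A * B *\<^sub>v v = A *\<^sub>v (B *\<^sub>v v)" using A B vv by (simp add: Sp_mult_mult_vec)
  \<comment> \<open>Replacing the image under \<open>B\<close> by its 0-1 representative makes the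
    assumption on \<open>A\<close> applicable; \<open>tr_eq_transfer\<close> shows that
    \<open>tr\<close> is unaffected after applying \<open>A\<close>.\<close>
  define x where "x = lift_vec (red_vec (B *\<^sub>v v))"
  have x: "x \<in> binary g" "red_vec (B *\<^sub>v v) = red_vec x"
    using B vv by (auto simp: x_def intro!: lift_vec_binary)
  have "tr (B *\<^sub>v v) = tr x" by (rule preserves_reductionD[OF B(2) v(1) x(1) v(2) x(2)])
  then have 1: "tr (A *\<^sub>v (B *\<^sub>v v)) = tr (A *\<^sub>v x)"
    using A B vv binary_vecs[OF x(1)] by (intro tr_eq_transfer) auto
  have "red_vec (A *\<^sub>v x) = red_vec w"
    using red_mult_vec[OF Sp_carrier_mat[OF A(1)]] red AB x(2) B(1) vv binary_vecs[OF x(1)] by (metis Sp_mult_vec_closed)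
  then have "tr (A *\<^sub>v x) = tr w"
    using preserves_reductionD[OF A(2) x(1) w] red_image_nonzero[OF B(1) v x(2)] by blast
  then show "tr (A * B *\<^sub>v v) = tr w" using 1 AB by simp
qed

text \<open>The congruence is turned around: \<open>A\<close> maps \<open>w\<close> into the class
  of \<open>v\<close>, so the assumption applies to \<open>w\<close>, and
  \<open>tr_eq_transfer\<close> carries the result back.\<close>

lemma preserves_reduction_inv:
  assumes A: "A \<in> carrier (Sp TYPE(int) g)" "preserves_reduction A"
  shows "preserves_reduction (inv\<^bsub>Sp TYPE(int) g\<^esub> A)"
  unfolding preserves_reduction_def
proof (intro ballI impI)
  let ?B = "inv\<^bsub>Sp TYPE(int) g\<^esub> A"
  fix v w assume v: "v \<in> binary g" "v \<noteq> 0\<^sub>v (2 * g)" and w: "w \<in> binary g"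
    and red: "red_vec (?B *\<^sub>v v) = red_vec w"
  note vv = binary_vecs[OF v(1)] and wv = binary_vecs[OF w]
  have B: "?B \<in> carrier (Sp TYPE(int) g)" using group.inv_closed[OF group_Sp A(1)] .
  have "red_vec (A *\<^sub>v w) = red_vec (A *\<^sub>v (?B *\<^sub>v v))"
    using red_mult_vec[OF Sp_carrier_mat[OF A(1)]] red wv Sp_mult_vec_closed[OF B vv] by metis
  then have "red_vec (A *\<^sub>v w) = red_vec v" using Sp_inv_mult_vec(2)[OF A(1) vv] by simp
  then have "tr (A *\<^sub>v w) = tr v"
    using preserves_reductionD[OF A(2) w v(1)] red_image_nonzero[OF B v red] by blast
  then have "tr (?B *\<^sub>v (A *\<^sub>v w)) = tr (?B *\<^sub>v v)"
    using A(1) B wv vv by (intro tr_eq_transfer) auto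
  then show "tr (?B *\<^sub>v v) = tr w" using Sp_inv_mult_vec(1)[OF A(1) wv] by simp
qed

end

section \<open>Quotients that are not larger than the reduction\<close>

locale Sp_small_quotient = Sp_noncyclic_quotient +
  assumes g_pos: "0 < g" and small: "\<not> carrier (Sp TYPE(bit) g) \<prec> carrier H"
begin

text \<open>Composing \<open>h\<close> with a section of \<open>red_mat\<close> is injective. As
  \<open>H\<close> is not larger than the finite source, the composite is onto.\<close>

lemma bijective_transversal:
  obtains s where "\<And>A. A \<in> carrier (Sp TYPE(bit) g) \<Longrightarrow> s A \<in> carrier (Sp TYPE(int) g)"
    "\<And>A. A \<in> carrier (Sp TYPE(bit) g) \<Longrightarrow> red_mat (s A) = A"
    "\<And>A. A \<in> carrier (Sp TYPE(bit) g) \<Longrightarrow> s A *\<^sub>v ea g 0 \<in> binary g"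
    "h ` s ` carrier (Sp TYPE(bit) g) = carrier H"
proof -
  let ?Q = "carrier (Sp TYPE(bit) g)"
  obtain R where R: "R \<subseteq> carrier (Sp TYPE(int) g)" "?Q \<subseteq> red_mat ` R" "inj_on h R"
    "\<And>A. A \<in> R \<Longrightarrow> A *\<^sub>v ea g 0 \<in> binary g"
    using exists_transversal[of 0] g_pos by (auto simp: stab_0)
  define s where "s = inv_into R red_mat"
  have s: "s A \<in> R" "red_mat (s A) = A" if "A \<in> ?Q" for A
    using that R(2) by (auto simp: s_def inv_into_into f_inv_into_f)
  have inj: "inj_on (h \<circ> s) ?Q"
    by (intro inj_onI) (metis R(3) comp_apply inj_onD s)
  have sub: "(h \<circ> s) ` ?Q \<subseteq> carrier H" using s(1) R(1) by (auto intro!: hom_closed)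
  then have "?Q \<lesssim> carrier H" unfolding lepoll_def using inj by blast
  then have "?Q \<approx> carrier H" using small by (auto simp: lesspoll_def)
  then have "finite (carrier H)" "card ?Q = card (carrier H)"
    using finite_carrier_Sp_bit eqpoll_finite_iff eqpoll_iff_card by blast+
  moreover from this have "card ((h \<circ> s) ` ?Q) = card (carrier H)"
    using card_image[OF inj] by argo
  ultimately have "(h \<circ> s) ` ?Q = carrier H"
    using sub by (metis card_subset_eq)
  then show ?thesis using that[of s] s R by (auto simp: image_comp)
qed

text \<open>\<open>h A\<close> equals \<open>h\<close> of some representative, and representatives
  map \<open>ea g 0\<close> to 0-1 vectors.\<close>

lemma tr_eq_tr_binary:
  assumes "A \<in> carrier (Sp TYPE(int) g)"
  shows "\<exists>w\<in>binary g. tr (A *\<^sub>v ea g 0) = tr w"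
proof -
  obtain s where s: "\<And>A. A \<in> carrier (Sp TYPE(bit) g) \<Longrightarrow> s A \<in> carrier (Sp TYPE(int) g)"
    "\<And>A. A \<in> carrier (Sp TYPE(bit) g) \<Longrightarrow> s A *\<^sub>v ea g 0 \<in> binary g"
    "h ` s ` carrier (Sp TYPE(bit) g) = carrier H"
    using bijective_transversal by metis
  then obtain B where "B \<in> carrier (Sp TYPE(bit) g)" "h A = h (s B)"
    using hom_closed[OF assms] by (metis (no_types, lifting) imageE)
  then show ?thesis using tr_cong[OF assms s(1)] s(2) by (metis unit_vec_carrier)
qed

text \<open>Writing \<open>v\<close> as an image of \<open>ea g 0\<close> yields a 0-1 vector
  \<open>x\<close> with the same \<open>tr\<close> as the image of \<open>v\<close>. The bound on
  entries identifies the residue classes, so \<open>x = w\<close>.\<close>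

lemma preserves_reduction_basic:
  assumes u: "u \<in> basic_vecs g 0"
  shows "preserves_reduction (transvection g u)"
  unfolding preserves_reduction_def
proof (intro ballI impI)
  fix v w assume v: "v \<in> binary g" "v \<noteq> 0\<^sub>v (2 * g)" and w: "w \<in> binary g"
    and red: "red_vec (transvection g u *\<^sub>v v) = red_vec w"
  have T: "transvection g u \<in> carrier (Sp TYPE(int) g)"
    by (rule transvection_in_Sp[OF basic_vecs_vecs[OF u]])
  obtain A where A: "A \<in> carrier (Sp TYPE(int) g)" "A *\<^sub>v ea g 0 = v"
    using exists_lift_of_ea[OF v(1) _ v(2) g_pos] v(1) by (auto simp: stab_0 supported_def binary_def)
  have "transvection g u *\<^sub>v v = (transvection g u * A) *\<^sub>v ea g 0"
    using A T by (simp add: Sp_mult_mult_vec)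
  then obtain x where x: "x \<in> binary g" "tr (transvection g u *\<^sub>v v) = tr x"
    using tr_eq_tr_binary[OF Sp_mult_closed[OF T A(1)]] by metis
  have "red_vec (transvection g u *\<^sub>v v) = red_vec x"
    using T binary_vecs[OF v(1)] x basic_transvection_entries[OF u v(1)]
    by (intro red_eq_of_tr_eq) auto
  then have "x = w" using red binary_red_inj[OF x(1) w] by simp
  then show "tr (transvection g u *\<^sub>v v) = tr w" using x by simp
qed

lemma preserves_reduction_Sp:
  assumes "A \<in> carrier (Sp TYPE(int) g)"
  shows "preserves_reduction A"
proof -
  have "A \<in> generate (Sp TYPE(int) g) (transvection g ` basic_vecs g 0)"
    using assms Sp_eq_elementary[of g] by (simp add: elementary_def)
  then have "A \<in> carrier (Sp TYPE(int) g) \<and> preserves_reduction A"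
  proof (induction rule: generate.induct)
    case one
    have "preserves_reduction (1\<^sub>m (2 * g))"
      unfolding preserves_reduction_def
    proof (intro ballI impI)
      fix v w assume "v \<in> binary g" "w \<in> binary g" "red_vec (1\<^sub>m (2 * g) *\<^sub>v v) = red_vec w"
      then show "tr (1\<^sub>m (2 * g) *\<^sub>v v) = tr w"
        using binary_red_inj[of v g w] binary_vecs[of v g] by simp
    qed
    then show ?case using G.one_closed by simp
  next
    case (incl A)
    then show ?case using preserves_reduction_basic transvection_in_Sp basic_vecs_vecs by blast
  next
    case (inv A)
    then have "A \<in> carrier (Sp TYPE(int) g)" "preserves_reduction A"
      using preserves_reduction_basic transvection_in_Sp basic_vecs_vecs by blast+
    then show ?case using preserves_reduction_inv group.inv_closed[OF group_Sp] by blast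
  next
    case (eng A B)
    then show ?case using preserves_reduction_mult[of A B] Sp_mult_closed[of A g B] by simp
  qed
  then show ?thesis ..
qed

text \<open>For \<open>A\<close> in the kernel, \<open>tr\<close> agrees on \<open>v\<close> and its
  image, hence on \<open>v\<close> and the 0-1 representative of that image. By injectivity of
  \<open>tr\<close> each basis vector is fixed modulo 2.\<close>

lemma kernel_le:
  assumes A: "A \<in> carrier (Sp TYPE(int) g)" and "h A = \<one>"
  shows "red_mat A = 1\<^sub>m (2 * g)"
proof (rule mat_eq_vecI[of _ "2 * g" "2 * g"])
  have Am: "A \<in> carrier_mat (2 * g) (2 * g)" using A by (rule Sp_carrier_mat)
  then show "red_mat A \<in> carrier_mat (2 * g) (2 * g)" by simp
  fix j assume j: "j < 2 * g"
  define v where "v = (unit_vec (2 * g) j :: int vec)"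
  have v: "v \<in> binary g" "v \<noteq> 0\<^sub>v (2 * g)" using j by (auto simp: v_def binary_def)
  define w where "w = lift_vec (red_vec (A *\<^sub>v v))"
  have w: "w \<in> binary g" "red_vec (A *\<^sub>v v) = red_vec w"
    using A binary_vecs[OF v(1)] by (auto simp: w_def intro!: lift_vec_binary)
  have one: "1\<^sub>m (2 * g) \<in> carrier (Sp TYPE(int) g)"
    using G.one_closed by simp
  have "tr (A *\<^sub>v v) = tr w"
    by (rule preserves_reductionD[OF preserves_reduction_Sp[OF A] v(1) w(1) v(2) w(2)])
  moreover have "tr (A *\<^sub>v v) = tr v"
    using tr_cong[OF A one _ binary_vecs[OF v(1)]] assms(2) hom_one binary_vecs[OF v(1)] by simp
  ultimately have "v = w" using inj_onD[OF tr_inj_on_binary _ v(1) w(1)] by simp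
  then have "red_mat A *\<^sub>v red_vec v = red_vec v"
    using red_mult_vec[OF Am binary_vecs[OF v(1)]] w(2) by simp
  then show "red_mat A *\<^sub>v unit_vec (2 * g) j = 1\<^sub>m (2 * g) *\<^sub>v unit_vec (2 * g) j"
    using j by (simp add: v_def)
qed auto

text \<open>For the other inclusion, all matrices reducing to the identity share the value of
  \<open>h\<close> at the representative of the identity; comparison with the identity matrix shows
  that this value is trivial.\<close>

lemma kernel_eq: "kernel (Sp TYPE(int) g) H h = kernel (Sp TYPE(int) g) (Sp TYPE(bit) g) red_mat"
proof -
  interpret red: group_hom "Sp TYPE(int) g" "Sp TYPE(bit) g" red_mat by (rule red_mat_hom)
  obtain s where s: "\<And>A. A \<in> carrier (Sp TYPE(bit) g) \<Longrightarrow> s A \<in> carrier (Sp TYPE(int) g)"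
    "\<And>A. A \<in> carrier (Sp TYPE(bit) g) \<Longrightarrow> red_mat (s A) = A"
    "h ` s ` carrier (Sp TYPE(bit) g) = carrier H"
    using bijective_transversal by metis
  have eq: "h A = h (s (1\<^sub>m (2 * g)))"
    if A: "A \<in> carrier (Sp TYPE(int) g)" "red_mat A = 1\<^sub>m (2 * g)" for A
  proof -
    obtain B where B: "B \<in> carrier (Sp TYPE(bit) g)" "h A = h (s B)"
      using s(3) hom_closed[OF A(1)] by (metis (no_types, lifting) imageE)
    \<comment> \<open>This quotient lies in the kernel, so it reduces to the identity; as
      \<open>A\<close> does too, \<open>B\<close> is the identity.\<close>
    let ?C = "inv\<^bsub>Sp TYPE(int) g\<^esub> A * s B"
    have iA: "inv\<^bsub>Sp TYPE(int) g\<^esub> A \<in> carrier (Sp TYPE(int) g)" using A(1) by simp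
    have "h ?C = \<one>" using B A(1) iA s(1) by (simp add: h_mult hom_inv)
    then have "red_mat ?C = 1\<^sub>m (2 * g)" using kernel_le Sp_mult_closed iA s(1) B(1) by blast
    moreover have "red_mat ?C = red_mat (inv\<^bsub>Sp TYPE(int) g\<^esub> A) * B"
      using red_mat_mult[OF iA s(1)[OF B(1)]] s(2)[OF B(1)] by simp
    moreover have "red_mat (inv\<^bsub>Sp TYPE(int) g\<^esub> A) = 1\<^sub>m (2 * g)"
      using red.hom_inv[OF A(1)] A(2) red.H.inv_one by simp
    ultimately have "B = 1\<^sub>m (2 * g)" using Sp_carrier_mat[OF B(1)] by simp
    then show ?thesis using B(2) by simp
  qed
  have "h A = \<one>" if A: "A \<in> carrier (Sp TYPE(int) g)" "red_mat A = 1\<^sub>m (2 * g)" for A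
  proof -
    have "1\<^sub>m (2 * g) \<in> carrier (Sp TYPE(int) g)" "red_mat (1\<^sub>m (2 * g)) = 1\<^sub>m (2 * g)" "h (1\<^sub>m (2 * g)) = \<one>"
      using G.one_closed red.hom_one hom_one by simp_all
    then show ?thesis using eq[OF A] eq[of "1\<^sub>m (2 * g)"] by simp
  qed
  then show ?thesis using kernel_le by (auto simp: kernel_def)
qed

end

section \<open>Abelian quotients\<close>

text \<open>Transvections along pairwise orthogonal vectors compose by adding their quadratic terms.
  The relation is the expansion identity for the squares of \<open>x + y + z\<close>,
  \<open>x\<close>, \<open>y\<close>, \<open>z\<close> against those of \<open>x + y\<close>,
  \<open>x + z\<close>, \<open>y + z\<close>.\<close>

lemma lantern_relation:
  assumes x: "x \<in> vecs g" "y \<in> vecs g" "z \<in> vecs g"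
    and ortho: "symp g x y = 0" "symp g x z = 0" "symp g y z = 0"
  shows "transvection g (x + y + z) * (transvection g x * (transvection g y * transvection g z))
    = transvection g (x + y) * (transvection g (x + z) * transvection g (y + z))"
    (is "?L = ?R")
proof (rule mat_eq_vecI[of _ "2 * g" "2 * g"])
  have ortho': "symp g y x = 0" "symp g z x = 0" "symp g z y = 0"
    using ortho symp_swap[of g y x] symp_swap[of g z x] symp_swap[of g z y] by simp_all
  note S = transvection_in_Sp[of _ g]
  have L: "?L \<in> carrier (Sp TYPE('a) g)" and R: "?R \<in> carrier (Sp TYPE('a) g)"
    using x by (auto intro!: Sp_mult_closed S)
  then show "?L \<in> carrier_mat (2 * g) (2 * g)" "?R \<in> carrier_mat (2 * g) (2 * g)"
    by (auto intro: Sp_carrier_mat)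
  fix j
  define w where "w = (unit_vec (2 * g) j :: 'a vec)"
  have w: "w \<in> vecs g" by (simp add: w_def)
  show "?L *\<^sub>v unit_vec (2 * g) j = ?R *\<^sub>v unit_vec (2 * g) j"
    unfolding w_def[symmetric]
    using x w by (simp add: Sp_mult_mult_vec[where g = g and ty = "TYPE('a)"] Sp_mult_closed S
        transvection_mult_vec symp_add_left symp_add_right symp_smult_right ortho ortho')
      (auto simp: algebra_simps intro!: eq_vecI)
qed

context Sp_quotient
begin

text \<open>All vectors with a partner of pairing 1 are conjugate, so an abelian quotient gives them
  one common value \<open>t\<close>. Three orthogonal basis vectors, available for
  \<open>g \<ge> 3\<close>, then feed the lantern relation.\<close>

lemma comm_imp_trivial:
  assumes g: "3 \<le> g" and comm: "comm_group H"
  shows "trivial_group H"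
proof -
  interpret C: comm_group H by (rule comm)
  define t where "t = tr (ea g 0)"
  have t: "t \<in> carrier H" by (simp add: t_def)
  have tr: "tr u = t" if u: "u \<in> vecs g" and w: "w \<in> vecs g" and uw: "symp g u w = 1" for u w
  proof -
    obtain A where A: "A \<in> carrier (Sp TYPE(int) g)" "A *\<^sub>v ea g 0 = u"
      using Sp_pair_transitive[of g "ea g 0" "eb g 0" u w] u w uw g by auto
    have "h A \<otimes> t = tr u \<otimes> h A" using tr_conj[OF A(1), of "ea g 0"] A(2) by (simp add: t_def)
    also have "\<dots> = h A \<otimes> tr u" using A(1) u by (intro C.m_comm) auto
    finally show ?thesis using A(1) u t by simp
  qed
  have basic: "tr u = t" if u: "u \<in> basic_vecs g 0" for u
  proof -
    consider (a) i where "i < g" "u = ea g i" | (b) i where "i < g" "u = eb g i"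
      | (ab) i j where "i < g" "j < g" "i \<noteq> j" "u = ea g i - ea g j"
      using u by (auto simp: basic_vecs_def)
    then show ?thesis
    proof cases
      case a
      then show ?thesis by (intro tr[of u "eb g i"]) auto
    next
      case b
      then show ?thesis by (intro tr[of u "- 1 \<cdot>\<^sub>v ea g i"]) (auto simp: symp_smult_right)
    next
      case ab
      then show ?thesis by (intro tr[of u "eb g i"]) (auto simp: symp_diff_left)
    qed
  qed
  let ?x = "ea g 0 :: int vec" and ?y = "ea g 1 :: int vec" and ?z = "ea g 2 :: int vec"
  have "tr (?x + ?y + ?z) = t" "tr (?x + ?y) = t" "tr (?x + ?z) = t" "tr (?y + ?z) = t"
    using g tr[of "?x + ?y + ?z" "eb g 0"] tr[of "?x + ?y" "eb g 0"] tr[of "?x + ?z" "eb g 0"]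
      tr[of "?y + ?z" "eb g 1"]
    by (simp_all add: symp_add_left)
  moreover have "tr ?x = t" "tr ?y = t" "tr ?z = t"
    using g by (auto intro!: basic simp: basic_vecs_def)
  moreover have "tr (?x + ?y + ?z) \<otimes> (tr ?x \<otimes> (tr ?y \<otimes> tr ?z)) = tr (?x + ?y) \<otimes> (tr (?x + ?z) \<otimes> tr (?y + ?z))"
    using arg_cong[OF lantern_relation[of ?x g ?y ?z], of h] g
    by (simp add: h_mult Sp_mult_closed transvection_in_Sp tr_def)
  \<comment> \<open>Four transvections on one side against three on the other force \<open>t\<close>
    to be trivial.\<close>
  ultimately have "t \<otimes> (t \<otimes> (t \<otimes> t)) = t \<otimes> (t \<otimes> t)" by simp
  then have "t = \<one>" using t by (metis H.m_closed H.l_one H.one_closed H.right_cancel)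
  then have "tr ` basic_vecs g 0 \<subseteq> {\<one>}" using basic by auto
  then have "generate H (tr ` basic_vecs g 0) \<subseteq> {\<one>}"
    using H.mono_generate[of "tr ` basic_vecs g 0" "{\<one>}"] H.generate_one by simp
  then have "carrier H \<subseteq> {\<one>}"
    using generated_by_basic by simp
  then show ?thesis by (simp add: H.trivial_group_subset)
qed

end

section \<open>Normal subgroups as kernels, and minimality\<close>

lemma Sp_quotient_Mod:
  assumes N: "N \<lhd> Sp TYPE(int) g"
  shows "Sp_quotient g (Sp TYPE(int) g Mod N) (r_coset (Sp TYPE(int) g) N)"
    and "kernel (Sp TYPE(int) g) (Sp TYPE(int) g Mod N) (r_coset (Sp TYPE(int) g) N) = N"
proof -
  interpret N: normal N "Sp TYPE(int) g" by (rule N)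
  show "Sp_quotient g (Sp TYPE(int) g Mod N) (r_coset (Sp TYPE(int) g) N)"
    by (intro Sp_quotient.intro group_hom.intro group_hom_axioms.intro Sp_quotient_axioms.intro
        group_Sp N.factorgroup_is_group N.r_coset_hom_Mod carrier_FactGroup[symmetric])
  show "kernel (Sp TYPE(int) g) (Sp TYPE(int) g Mod N) (r_coset (Sp TYPE(int) g) N) = N"
    using N.coset_join1[OF _ _ N.subgroup_axioms] N.coset_join2[OF _ N.subgroup_axioms] N.subset
    by (auto simp: kernel_def)
qed

theorem corollary6:
  fixes g :: nat
  shows "(g \<ge> 1 \<longrightarrow> smallest_noncyclic_quotient (Sp TYPE(int) g) (Sp TYPE(bit) g)) \<and>
         (g \<ge> 3 \<longrightarrow> smallest_nontrivial_quotient (Sp TYPE(int) g) (Sp TYPE(bit) g))"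
proof -
  let ?S = "Sp TYPE(int) g" and ?Q = "Sp TYPE(bit) g"
  interpret red: group_hom ?S ?Q red_mat by (rule red_mat_hom)
  define K where "K = kernel ?S ?Q red_mat"
  have K: "K \<lhd> ?S" unfolding K_def by (rule red.normal_kernel)
  have K_grp: "group (?S Mod K)" by (rule normal.factorgroup_is_group[OF K])
  have iso: "?S Mod K \<cong> ?Q" if "g \<ge> 1"
    unfolding K_def using red_mat_surj[of g] that by (intro red.FactGroup_iso) simp
  have noncyclic: "\<not> cyclic_group (?S Mod K)" if "g \<ge> 1"
    using isomorphic_group_cyclicity[OF iso K_grp group_Sp] Sp_not_cyclic[of g, where 'a = bit] that by simp
  have smallest: "carrier ?Q \<prec> carrier (?S Mod N) \<or> ?S Mod N \<cong> ?Q"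
    if g: "g \<ge> 1" and N: "N \<lhd> ?S" and nc: "\<not> cyclic_group (?S Mod N)" for N
  proof (cases "carrier ?Q \<prec> carrier (?S Mod N)")
    case small: False
    interpret Sp_quotient g "?S Mod N" "r_coset ?S N" by (rule Sp_quotient_Mod[OF N])
    interpret Sp_small_quotient g "?S Mod N" "r_coset ?S N"
      using nc g small by unfold_locales auto
    \<comment> \<open>The two kernels coincide as subgroups, so the isomorphism is the one already
      known for the reduction.\<close>
    have "N = K" using kernel_eq Sp_quotient_Mod(2)[OF N] by (simp add: K_def)
    then show ?thesis using iso[OF g] by simp
  qed simp
  have nontrivial: "\<not> cyclic_group (?S Mod N)"
    if g: "g \<ge> 3" and N: "N \<lhd> ?S" and nt: "\<not> trivial_group (?S Mod N)" for N
  proof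
    \<comment> \<open>Cyclic quotients are abelian, hence trivial for \<open>g \<ge> 3\<close>; the
      second claim thereby reduces to the first.\<close>
    assume "cyclic_group (?S Mod N)"
    then have "comm_group (?S Mod N)"
      by (rule group.cyclic_imp_abelian_group[OF normal.factorgroup_is_group[OF N]])
    then show False
      using Sp_quotient.comm_imp_trivial[OF Sp_quotient_Mod(1)[OF N] g] nt by blast
  qed
  show ?thesis
    unfolding smallest_noncyclic_quotient_def smallest_nontrivial_quotient_def smallest_quotient_def
  proof (intro conjI impI)
    assume g: "g \<ge> 1"
    show "\<exists>N. N \<lhd> ?S \<and> \<not> cyclic_group (?S Mod N) \<and> ?S Mod N \<cong> ?Q"
      using K noncyclic[OF g] iso[OF g] by blast
    show "\<forall>N. N \<lhd> ?S \<and> \<not> cyclic_group (?S Mod N) \<longrightarrow> carrier ?Q \<prec> carrier (?S Mod N) \<or> ?S Mod N \<cong> ?Q"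
      using smallest[OF g] by blast
  next
    assume g: "g \<ge> 3"
    then have g1: "g \<ge> 1" by simp
    show "\<exists>N. N \<lhd> ?S \<and> \<not> trivial_group (?S Mod N) \<and> ?S Mod N \<cong> ?Q"
      using K noncyclic[OF g1] iso[OF g1] trivial_imp_cyclic_group by blast
    show "\<forall>N. N \<lhd> ?S \<and> \<not> trivial_group (?S Mod N) \<longrightarrow> carrier ?Q \<prec> carrier (?S Mod N) \<or> ?S Mod N \<cong> ?Q"
      using smallest[OF g1] nontrivial[OF g] by blast
  qed
qed

end
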